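(* Let $\Phi$ be an $m\times N$ real matrix with unit-norm columns and coherence $\mu$, and let $\theta=\bar\mu^2$ if $\Phi$ is coherence-invariant and $\theta=\bar\mu_{\max}^2$ otherwise. Let $1\le k\le N$, $\delta\in(0,1)$, and $0<\epsilon<\min\{1/k,\,e^{1-1/\log2}\}$. Suppose that $$k\mu^4\le\frac{1}{\log^2(1/\epsilon)}\min\Bigl(\frac{(1-a)^2b^2}{32\log(2k)\log(e/\epsilon)},\,c^2\Bigr)\quad\text{and}\quad k\theta\le\frac{ab}{\log(1/\epsilon)},$$ where $a,b,c\in(0,1)$ are constants such that $$\sqrt{b}+\sqrt{2ab}+\sqrt{c}+\frac{2k}{N}\|\Phi\|^2\le\frac{e^{-1/4}\delta}{6\sqrt2}.$$ Then $\Phi$ is $(k,\delta,\epsilon)$-StRIP.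
   Context: $\log$ is the natural logarithm; $\|\cdot\|$ on matrices is the spectral norm; $[N]=\{1,\dots,N\}$. Let $\phi_1,\dots,\phi_N$ be the columns of $\Phi$ and $\mu_{ij}=|\phi_i^T\phi_j|$. The coherence is $\mu=\max_{i\ne j}\mu_{ij}$; the mean square coherence is $\bar\mu^2=\frac1{N(N-1)}\sum_{i\ne j}\mu_{ij}^2$; the maximum average square coherence is $\bar\mu^2_{\max}=\max_{1\le j\le N}\frac1{N-1}\sum_{i\ne j}\mu_{ij}^2$. $\Phi$ is coherence-invariant if the multiset $\{\mu_{ij}:j\in[N]\setminus\{i\}\}$ does not depend on $i\in[N]$. For $I\subset[N]$, $\Phi_I$ is the submatrix of $\Phi$ with columns indexed by $I$. $\Phi$ is $(k,\delta,\epsilon)$-StRIP if, for $I$ a uniformly random $k$-subset of $[N]$, $\Pr(\|\Phi_I^T\Phi_I-\mathrm{Id}\|\le\delta)\ge1-\epsilon$. *)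

theory Defs
  imports
    "HOL-Probability.Probability_Mass_Function"
    "HOL-Library.Multiset"
    "Jordan_Normal_Form.Matrix"
    "Jordan_Normal_Form.DL_Submatrix"
begin

text \<open>
  Matrices are those of Jordan_Normal_Form, since the submatrix \<open>\<Phi>\<^sub>I\<close> has a number of columns
  that depends on \<open>I\<close>.  The columns are indexed from 0, so \<open>[N]\<close> becomes \<open>{..<N}\<close>
  with \<open>N = dim_col \<Phi>\<close>.
\<close>

definition l2_norm_vec :: "real vec \<Rightarrow> real" where
  "l2_norm_vec v = sqrt (scalar_prod v v)"

definition spectral_norm :: "real mat \<Rightarrow> real" where
  "spectral_norm A =
     Sup {l2_norm_vec (A *\<^sub>v x) | x. x \<in> carrier_vec (dim_col A) \<and> l2_norm_vec x \<le> 1}"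

definition unit_norm_columns :: "real mat \<Rightarrow> bool" where
  "unit_norm_columns \<Phi> \<longleftrightarrow> (\<forall>j<dim_col \<Phi>. l2_norm_vec (col \<Phi> j) = 1)"

definition mutual_coherence :: "real mat \<Rightarrow> nat \<Rightarrow> nat \<Rightarrow> real" where
  "mutual_coherence \<Phi> i j = \<bar>scalar_prod (col \<Phi> i) (col \<Phi> j)\<bar>"

text \<open>
  The three coherence parameters are meaningful for \<open>N \<ge> 2\<close> only: for \<open>N = 1\<close> the first is the
  unspecified \<open>Max {}\<close>, and the other two are 0 because division by zero yields 0.
\<close>

definition coherence :: "real mat \<Rightarrow> real" where
  "coherence \<Phi> =
     Max {mutual_coherence \<Phi> i j | i j. i < dim_col \<Phi> \<and> j < dim_col \<Phi> \<and> i \<noteq> j}"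

definition mean_sq_coherence :: "real mat \<Rightarrow> real" where
  "mean_sq_coherence \<Phi> = (let N = dim_col \<Phi> in
     1 / (real N * (real N - 1)) *
       (\<Sum>i<N. \<Sum>j\<in>{..<N} - {i}. (mutual_coherence \<Phi> i j)\<^sup>2))"

definition max_avg_sq_coherence :: "real mat \<Rightarrow> real" where
  "max_avg_sq_coherence \<Phi> = (let N = dim_col \<Phi> in
     Max ((\<lambda>j. 1 / (real N - 1) * (\<Sum>i\<in>{..<N} - {j}. (mutual_coherence \<Phi> i j)\<^sup>2)) ` {..<N}))"

definition coherence_invariant :: "real mat \<Rightarrow> bool" where
  "coherence_invariant \<Phi> \<longleftrightarrow>
     (\<forall>i<dim_col \<Phi>. \<forall>i'<dim_col \<Phi>.
        image_mset (mutual_coherence \<Phi> i) (mset_set ({..<dim_col \<Phi>} - {i})) =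
        image_mset (mutual_coherence \<Phi> i') (mset_set ({..<dim_col \<Phi>} - {i'})))"

definition column_submatrix :: "real mat \<Rightarrow> nat set \<Rightarrow> real mat" where
  "column_submatrix \<Phi> I = submatrix \<Phi> UNIV I"

definition strip :: "real mat \<Rightarrow> nat \<Rightarrow> real \<Rightarrow> real \<Rightarrow> bool" where
  "strip \<Phi> k \<delta> \<epsilon> \<longleftrightarrow>
     measure_pmf.prob (pmf_of_set {I. I \<subseteq> {..<dim_col \<Phi>} \<and> card I = k})
       {I. spectral_norm
             (transpose_mat (column_submatrix \<Phi> I) * column_submatrix \<Phi> I - 1\<^sub>m k) \<le> \<delta>}
     \<ge> 1 - \<epsilon>"

end

theory Submission
  imports Defs
begin

text \<open>
  Let \<open>h = \<Phi>\<^sup>T\<Phi> - Id\<close>.  Every off-diagonal entry of \<open>h\<close> on \<open>I\<close> lies equally often in a block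
  \<open>(I - J) \<times> J\<close> with \<open>J\<close> half of \<open>I\<close>, so \<open>\<parallel>h\<^sub>I\<parallel>\<close> is at most twice the average norm of these
  blocks, and it suffices that a random pair of disjoint sets \<open>(A, J)\<close> gives a large block with
  probability \<open>O(\<epsilon>\<^sup>6 k)\<close>; on the exceptional event the entrywise bound \<open>k\<mu>\<close> is affordable.
  The block is exposed in two steps, each controlled by a matrix Chernoff bound for sums of rank-one
  matrices sampled without replacement: first the columns \<open>J\<close> of \<open>h\<close>, then the rows \<open>A\<close> of
  \<open>h\<^sub>J\<close>, whose norms are at most \<open>sqrt (b / log (1/\<epsilon>))\<close> up to a third, scalar, Chernoff bound.

  The Chernoff bound follows \<open>E tr (e\<^bsup>\<tau>S\<^esup> - Id)\<close> along the sampling.  Subtracting the identity makes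
  the bound proportional to the number of samples instead of the dimension.  As the summands have
  rank one, the Golden-Thompson inequality is needed only in a form that reduces to the log-convexity of
  the moments \<open>\<langle>x, S\<^sup>p x\<rangle>\<close>.
\<close>

section \<open>Trace moments under rank-one updates\<close>

text \<open>With \<open>L = ln (1 / \<epsilon>)\<close>, the number \<open>b / L\<close> caps the
  squared norms of the rows of \<open>h\<close> restricted to \<open>J\<close>. The hypothesis on
  \<open>k\<theta>\<close> keeps their mean at most the fraction \<open>a\<close> of this cap, and
  the hypothesis on \<open>k\<mu>^4\<close> makes a deviation by the remaining fraction
  \<open>1 - a\<close> rare. In the numerical condition \<open>sqrt b\<close> is the price of the
  cap in the row step, \<open>sqrt (2 * a * b)\<close> that of the full column norms in the column
  step, and \<open>k / N\<close> times \<open>\<parallel>\<Phi>\<parallel>^2\<close> is what is left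
  of \<open>h\<close> itself, whose squared norm shrinks by a factor of order \<open>k / N\<close>
  in each step; \<open>c\<close> bounds \<mu> and thereby the cost of the exceptional event. Draws
  without replacement are dependent, but the summands are positive semidefinite: summed over the
  indices still available they are at most the full sum, so a lower bound \<open>K\<close> on the
  number of available indices suffices. No spectral decomposition occurs: a large value of a
  quadratic form is detected by the traces of powers, and exponentials stay Taylor polynomials up to
  one scalar limit. Probabilities are ratios of numbers of subsets.\<close>

definition ip :: "'u set \<Rightarrow> ('u \<Rightarrow> real) \<Rightarrow> ('u \<Rightarrow> real) \<Rightarrow> real" where
  "ip U x y = (\<Sum>u\<in>U. x u * y u)"

lemma ip_commute: "ip U x y = ip U y x"
  unfolding ip_def by (simp add: mult.commute)

lemma ip_add_right: "ip U z (\<lambda>u. x u + y u) = ip U z x + ip U z y"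
  unfolding ip_def by (simp add: distrib_left sum.distrib)

lemma ip_scale_right: "ip U z (\<lambda>u. c * x u) = c * ip U z x"
  unfolding ip_def by (simp add: sum_distrib_left algebra_simps)

lemma ip_sum_right: "ip U z (\<lambda>u. \<Sum>i\<in>I. f i u) = (\<Sum>i\<in>I. ip U z (f i))"
  unfolding ip_def sum_distrib_left by (rule sum.swap)

lemma ip_nonneg: "0 \<le> ip U x x"
  unfolding ip_def by (simp add: sum_nonneg)

lemma ip_Cauchy_Schwarz: "(ip U x y)\<^sup>2 \<le> ip U x x * ip U y y"
  using Cauchy_Schwarz_ineq_sum[of x y U] unfolding ip_def by (simp add: power2_eq_square)

abbreviation unit_fun :: "'u \<Rightarrow> 'u \<Rightarrow> real" where
  "unit_fun u \<equiv> (\<lambda>w. if w = u then 1 else 0)"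

text \<open>The positive semidefinite sum of the rank-one operators of the \<open>v j\<close>, kept
  as a map on functions so that its powers are plain iterates.\<close>

definition frame_op :: "'u set \<Rightarrow> ('i \<Rightarrow> 'u \<Rightarrow> real) \<Rightarrow> 'i set \<Rightarrow> ('u \<Rightarrow> real) \<Rightarrow> 'u \<Rightarrow> real" where
  "frame_op U v J y = (\<lambda>u. \<Sum>j\<in>J. ip U (v j) y * v j u)"

text \<open>Multiplying the bound for \<open>l\<close> by log-convexity leaves a common factor
  \<open>s (Suc l)\<close> to cancel; if it is zero, the claim is trivial. The division-free form of
  increasing ratios tolerates sequences that vanish.\<close>

lemma log_convex_ratio:
  fixes s :: "nat \<Rightarrow> real"
  assumes nn: "\<And>j. 0 \<le> s j" and lc: "\<And>j. (s (Suc j))\<^sup>2 \<le> s j * s (Suc (Suc j))"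
  shows "j \<le> l \<Longrightarrow> s (Suc j) * s l \<le> s j * s (Suc l)"
proof (induction l rule: dec_induct)
  case base
  show ?case by simp
next
  case (step l)
  show ?case
  proof (cases "s (Suc l) = 0")
    case True
    then show ?thesis using nn by simp
  next
    case False
    then have pos: "s (Suc l) > 0" using nn[of "Suc l"] by simp
    have "s (Suc j) * (s (Suc l))\<^sup>2 \<le> s (Suc j) * (s l * s (Suc (Suc l)))"
      by (intro mult_left_mono lc nn)
    also have "\<dots> = (s (Suc j) * s l) * s (Suc (Suc l))" by simp
    also have "\<dots> \<le> (s j * s (Suc l)) * s (Suc (Suc l))"
      by (intro mult_right_mono step.IH nn)
    finally have "(s (Suc j) * s (Suc l)) * s (Suc l) \<le> (s j * s (Suc (Suc l))) * s (Suc l)"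
      by (simp add: power2_eq_square algebra_simps)
    then show ?thesis using pos by (simp add: mult_le_cancel_right)
  qed
qed

text \<open>Moving one unit of index from the smaller to the larger argument does not decrease the
  product, and after \<open>j\<close> moves the smaller one is 0. Applied to the moments of a
  vector, this stands in for commutation in the rank-one Golden-Thompson bound.\<close>

lemma log_convex_mult_le:
  fixes s :: "nat \<Rightarrow> real"
  assumes nn: "\<And>j. 0 \<le> s j" and lc: "\<And>j. (s (Suc j))\<^sup>2 \<le> s j * s (Suc (Suc j))"
  shows "s j * s l \<le> s 0 * s (j + l)"
proof -
  have *: "s j * s l \<le> s 0 * s (j + l)" if "j \<le> l" for j l
    using that
  proof (induction j arbitrary: l)
    case 0
    show ?case by simp
  next
    case (Suc j)
    have "s (Suc j) * s l \<le> s j * s (Suc l)"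
      using log_convex_ratio[of s j l, OF nn lc] Suc.prems by simp
    also have "\<dots> \<le> s 0 * s (j + Suc l)"
      using Suc.prems by (intro Suc.IH) simp
    finally show ?case by simp
  qed
  show ?thesis
  proof (cases "j \<le> l")
    case True
    then show ?thesis by (rule *)
  next
    case False
    then have "s l * s j \<le> s 0 * s (l + j)" by (intro *) simp
    then show ?thesis by (simp add: mult.commute add.commute)
  qed
qed

text \<open>A discrete Jensen inequality; for the moments \<open>s p\<close> of a vector it compares
  the mean with the higher moments.\<close>

lemma log_convex_power_le:
  fixes s :: "nat \<Rightarrow> real"
  assumes nn: "\<And>j. 0 \<le> s j" and lc: "\<And>j. (s (Suc j))\<^sup>2 \<le> s j * s (Suc (Suc j))"
  shows "(s 1) ^ Suc p \<le> s 0 ^ p * s (Suc p)"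
proof (induction p)
  case 0
  show ?case by simp
next
  case (Suc p)
  have "s 1 ^ Suc (Suc p) = s 1 * s 1 ^ Suc p" by simp
  also have "\<dots> \<le> s 1 * (s 0 ^ p * s (Suc p))" by (intro mult_left_mono Suc.IH nn)
  also have "\<dots> = s 0 ^ p * (s 1 * s (Suc p))" by simp
  also have "\<dots> \<le> s 0 ^ p * (s 0 * s (1 + Suc p))"
    using log_convex_mult_le[of s 1 "Suc p", OF nn lc] by (intro mult_left_mono zero_le_power nn)
  finally show ?case by (simp add: algebra_simps)
qed

section \<open>Moments and traces of a sum of rank-one operators\<close>

locale finite_family =
  fixes U :: "'u set" and v :: "'i \<Rightarrow> 'u \<Rightarrow> real"
  assumes finU: "finite U"
begin

abbreviation inner_U (infix "\<bullet>\<^sub>U" 70) where "x \<bullet>\<^sub>U y \<equiv> ip U x y"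
abbreviation "S \<equiv> frame_op U v"
definition "tr_pow J p = (\<Sum>u\<in>U. unit_fun u \<bullet>\<^sub>U ((S J ^^ p) (unit_fun u)))"

lemma ip_unit: "u \<in> U \<Longrightarrow> unit_fun u \<bullet>\<^sub>U x = x u"
proof -
  assume u: "u \<in> U"
  have "unit_fun u \<bullet>\<^sub>U x = (\<Sum>w\<in>U. if w = u then x w else 0)"
    unfolding ip_def by (intro sum.cong) auto
  then show ?thesis using u finU by simp
qed

lemma ip_unit': "u \<in> U \<Longrightarrow> x \<bullet>\<^sub>U unit_fun u = x u"
  by (subst ip_commute) (rule ip_unit)

lemma parseval: "x \<bullet>\<^sub>U y = (\<Sum>u\<in>U. (x \<bullet>\<^sub>U unit_fun u) * (unit_fun u \<bullet>\<^sub>U y))"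
  by (simp add: ip_unit ip_unit') (simp add: ip_def)

lemma frame_op_linear: "S J (\<lambda>u. x u + c * y u) = (\<lambda>u. S J x u + c * S J y u)"
  unfolding frame_op_def
  by (rule ext) (simp add: ip_add_right ip_scale_right algebra_simps sum.distrib sum_distrib_left)

lemma frame_op_pow_linear: "(S J ^^ q) (\<lambda>u. x u + c * y u) = (\<lambda>u. (S J ^^ q) x u + c * (S J ^^ q) y u)"
  by (induction q) (simp_all add: frame_op_linear)

lemma ip_frame_op: "x \<bullet>\<^sub>U S J y = (\<Sum>j\<in>J. (x \<bullet>\<^sub>U v j) * (v j \<bullet>\<^sub>U y))"
  unfolding frame_op_def by (simp add: ip_sum_right ip_scale_right) (simp add: mult.commute)

lemma frame_op_self_adjoint: "S J x \<bullet>\<^sub>U y = x \<bullet>\<^sub>U S J y"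
  by (subst ip_commute) (simp add: ip_frame_op ip_commute mult.commute)

lemma frame_op_pow_self_adjoint: "(S J ^^ q) x \<bullet>\<^sub>U y = x \<bullet>\<^sub>U (S J ^^ q) y"
proof (induction q arbitrary: y)
  case (Suc q)
  have "(S J ^^ Suc q) x \<bullet>\<^sub>U y = (S J ^^ q) x \<bullet>\<^sub>U S J y"
    by (simp add: frame_op_self_adjoint)
  also have "\<dots> = x \<bullet>\<^sub>U (S J ^^ Suc q) y"
    by (simp only: Suc.IH funpow_Suc_right o_apply)
  finally show ?case .
qed simp

text \<open>Powers of the frame operator are again frame operators, the family consisting of the
  vectors \<open>S\<^sup>q e\<^sub>u\<close> for the power \<open>2q\<close> and of \<open>S\<^sup>q v\<^sub>j\<close> for the power \<open>2q + 1\<close>.\<close>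
lemma pow_frame:
  assumes "finite J"
  shows "\<exists>n (w :: nat \<Rightarrow> 'u \<Rightarrow> real). \<forall>x y. x \<bullet>\<^sub>U (S J ^^ p) y = (\<Sum>i<n. (x \<bullet>\<^sub>U w i) * (w i \<bullet>\<^sub>U y))"
proof -
  have enum: "\<exists>n (w :: nat \<Rightarrow> 'u \<Rightarrow> real). \<forall>x y. (\<Sum>t\<in>T. (x \<bullet>\<^sub>U f t) * (f t \<bullet>\<^sub>U y)) = (\<Sum>i<n. (x \<bullet>\<^sub>U w i) * (w i \<bullet>\<^sub>U y))"
    if fT: "finite T" for T :: "'t set" and f :: "'t \<Rightarrow> 'u \<Rightarrow> real"
  proof -
    obtain h where h: "bij_betw h {0..<card T} T" using ex_bij_betw_nat_finite[OF fT] by blast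
    then have h: "bij_betw h {..<card T} T" by (simp add: lessThan_atLeast0)
    show ?thesis
      by (intro exI[of _ "card T"] exI[of _ "\<lambda>i. f (h i)"] allI) (simp add: sum.reindex_bij_betw[OF h, symmetric])
  qed
  have split: "x \<bullet>\<^sub>U (S J ^^ (q + r)) y = (S J ^^ q) x \<bullet>\<^sub>U (S J ^^ r) y" for x y q r
    by (simp add: funpow_add frame_op_pow_self_adjoint)
  show ?thesis
  proof (cases "even p")
    case True
    then obtain q where q: "p = q + q" by (metis evenE mult_2)
    have *: "x \<bullet>\<^sub>U (S J ^^ p) y = (\<Sum>u\<in>U. (x \<bullet>\<^sub>U (S J ^^ q) (unit_fun u)) * ((S J ^^ q) (unit_fun u) \<bullet>\<^sub>U y))" for x y
      unfolding q split by (subst parseval) (simp add: frame_op_pow_self_adjoint)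
    show ?thesis unfolding * by (rule enum[OF finU])
  next
    case False
    then obtain q where q: "p = q + Suc q" by (metis oddE mult_2 add_Suc_right Suc_eq_plus1)
    have *: "x \<bullet>\<^sub>U (S J ^^ p) y = (\<Sum>j\<in>J. (x \<bullet>\<^sub>U (S J ^^ q) (v j)) * ((S J ^^ q) (v j) \<bullet>\<^sub>U y))" for x y
      unfolding q split by (simp add: ip_frame_op frame_op_pow_self_adjoint)
    show ?thesis unfolding * by (rule enum[OF assms])
  qed
qed

text \<open>Parseval for each \<open>w i\<close>. Together with \<open>pow_frame\<close> this does
  the work of a square root of the power: its quadratic form and its trace are both read off one
  finite family.\<close>

lemma pow_frame_trace:
  assumes "\<And>x y. x \<bullet>\<^sub>U (S J ^^ p) y = (\<Sum>i<n. (x \<bullet>\<^sub>U w i) * (w i \<bullet>\<^sub>U y))"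
  shows "tr_pow J p = (\<Sum>i<n. w i \<bullet>\<^sub>U w i)"
proof -
  have "tr_pow J p = (\<Sum>i<n. \<Sum>u\<in>U. (w i \<bullet>\<^sub>U unit_fun u) * (unit_fun u \<bullet>\<^sub>U w i))"
    unfolding tr_pow_def assms by (subst sum.swap) (simp add: mult.commute)
  then show ?thesis by (simp add: parseval[symmetric])
qed

lemma pow_nonneg:
  assumes "finite J"
  shows "0 \<le> x \<bullet>\<^sub>U (S J ^^ p) x"
proof -
  obtain n :: nat and w where w: "\<And>x y. x \<bullet>\<^sub>U (S J ^^ p) y = (\<Sum>i<n. (x \<bullet>\<^sub>U w i) * (w i \<bullet>\<^sub>U y))"
    using pow_frame[OF assms, of p] by blast
  show ?thesis unfolding w by (intro sum_nonneg) (simp add: ip_commute[of U _ x])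
qed

lemma tr_pow_nonneg: "finite J \<Longrightarrow> 0 \<le> tr_pow J p"
  unfolding tr_pow_def by (intro sum_nonneg pow_nonneg)

text \<open>The largest eigenvalue of a positive semidefinite operator is at most its trace; here
  this is Cauchy-Schwarz against each vector of the family that represents the power.\<close>

lemma pow_le_tr_pow:
  assumes "finite J"
  shows "x \<bullet>\<^sub>U (S J ^^ p) x \<le> (x \<bullet>\<^sub>U x) * tr_pow J p"
proof -
  obtain n :: nat and w where w: "\<And>x y. x \<bullet>\<^sub>U (S J ^^ p) y = (\<Sum>i<n. (x \<bullet>\<^sub>U w i) * (w i \<bullet>\<^sub>U y))"
    using pow_frame[OF assms, of p] by blast
  have "x \<bullet>\<^sub>U (S J ^^ p) x = (\<Sum>i<n. (x \<bullet>\<^sub>U w i)\<^sup>2)"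
    unfolding w by (simp add: power2_eq_square ip_commute)
  also have "\<dots> \<le> (\<Sum>i<n. (x \<bullet>\<^sub>U x) * (w i \<bullet>\<^sub>U w i))"
    by (intro sum_mono ip_Cauchy_Schwarz)
  finally show ?thesis unfolding pow_frame_trace[OF w] by (simp add: sum_distrib_left)
qed

text \<open>The operator bound \<Lambda> is applied to each vector \<open>w i\<close> representing
  the power. This is the trace inequality
  \<open>tr (W S\<^sup>p) \<le> \<parallel>W\<parallel> tr S\<^sup>p\<close> for the frame operator
  \<open>W\<close> of \<open>V\<close>.\<close>

lemma sum_pow_le_tr_pow:
  assumes "finite J" and "\<And>y. (\<Sum>x\<in>V. (v x \<bullet>\<^sub>U y)\<^sup>2) \<le> \<Lambda> * (y \<bullet>\<^sub>U y)"
  shows "(\<Sum>x\<in>V. v x \<bullet>\<^sub>U (S J ^^ p) (v x)) \<le> \<Lambda> * tr_pow J p"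
proof -
  obtain n :: nat and w where w: "\<And>x y. x \<bullet>\<^sub>U (S J ^^ p) y = (\<Sum>i<n. (x \<bullet>\<^sub>U w i) * (w i \<bullet>\<^sub>U y))"
    using pow_frame[OF assms(1), of p] by blast
  have "(\<Sum>x\<in>V. v x \<bullet>\<^sub>U (S J ^^ p) (v x)) = (\<Sum>i<n. \<Sum>x\<in>V. (v x \<bullet>\<^sub>U w i)\<^sup>2)"
    unfolding w by (subst sum.swap) (simp add: power2_eq_square ip_commute)
  also have "\<dots> \<le> (\<Sum>i<n. \<Lambda> * (w i \<bullet>\<^sub>U w i))"
    by (intro sum_mono assms(2))
  finally show ?thesis unfolding pow_frame_trace[OF w] by (simp add: sum_distrib_left)
qed

text \<open>Cauchy-Schwarz for the semi-inner product given by \<open>S J ^^ p\<close>, applied to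
  \<open>x\<close> and \<open>S J x\<close>.\<close>

lemma pow_log_convex:
  assumes "finite J"
  shows "(x \<bullet>\<^sub>U (S J ^^ Suc p) x)\<^sup>2 \<le> (x \<bullet>\<^sub>U (S J ^^ p) x) * (x \<bullet>\<^sub>U (S J ^^ Suc (Suc p)) x)"
proof -
  obtain n :: nat and w where w: "\<And>x y. x \<bullet>\<^sub>U (S J ^^ p) y = (\<Sum>i<n. (x \<bullet>\<^sub>U w i) * (w i \<bullet>\<^sub>U y))"
    using pow_frame[OF assms, of p] by blast
  have 1: "x \<bullet>\<^sub>U (S J ^^ Suc p) x = x \<bullet>\<^sub>U (S J ^^ p) (S J x)"
    by (simp only: funpow_Suc_right o_apply)
  have 2: "x \<bullet>\<^sub>U (S J ^^ Suc (Suc p)) x = S J x \<bullet>\<^sub>U (S J ^^ p) (S J x)"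
    by (simp only: funpow.simps(2) frame_op_self_adjoint 1[symmetric] o_apply)
       (simp only: funpow_swap1)
  show ?thesis unfolding 1 2 unfolding w
    using Cauchy_Schwarz_ineq_sum[of "\<lambda>i. x \<bullet>\<^sub>U w i" "\<lambda>i. w i \<bullet>\<^sub>U S J x" "{..<n}"]
    by (simp add: power2_eq_square ip_commute)
qed

lemma pow_mult_le:
  assumes "finite J"
  shows "(x \<bullet>\<^sub>U (S J ^^ p) x) * (x \<bullet>\<^sub>U (S J ^^ q) x) \<le> (x \<bullet>\<^sub>U x) * (x \<bullet>\<^sub>U (S J ^^ (p + q)) x)"
  using log_convex_mult_le[of "\<lambda>p. x \<bullet>\<^sub>U (S J ^^ p) x" p q] pow_log_convex[OF assms] pow_nonneg[OF assms]
  by simp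

text \<open>Substitute for an eigenvalue above \<open>t\<close>: Jensen for the moments of the test
  vector \<open>y\<close> carries the lower bound from the operator to its powers. Only positive
  exponents matter later, as the identity is subtracted from the exponential.\<close>

lemma tr_pow_ge:
  assumes "finite J" and "t * (y \<bullet>\<^sub>U y) < y \<bullet>\<^sub>U S J y" and "0 \<le> t"
  shows "t ^ Suc p \<le> tr_pow J (Suc p)"
proof -
  \<comment> \<open>A null vector cannot satisfy the strict hypothesis, since its quadratic form
    lies between 0 and 0 times a trace.\<close>
  have nz: "y \<bullet>\<^sub>U y > 0"
  proof (rule ccontr)
    assume "\<not> ?thesis"
    then have z: "y \<bullet>\<^sub>U y = 0" using ip_nonneg[of U y] by simp
    have "y \<bullet>\<^sub>U S J y = 0"
      using pow_le_tr_pow[OF assms(1), of y 1] pow_nonneg[OF assms(1), of y 1] z by simp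
    then show False using assms(2) z by simp
  qed
  have "(t * (y \<bullet>\<^sub>U y)) ^ Suc p \<le> (y \<bullet>\<^sub>U S J y) ^ Suc p"
    using assms(2,3) nz by (intro power_mono) simp_all
  also have "\<dots> \<le> (y \<bullet>\<^sub>U y) ^ p * (y \<bullet>\<^sub>U (S J ^^ Suc p) y)"
    using log_convex_power_le[of "\<lambda>p. y \<bullet>\<^sub>U (S J ^^ p) y" p] pow_log_convex[OF assms(1)] pow_nonneg[OF assms(1)]
    by simp
  also have "\<dots> \<le> (y \<bullet>\<^sub>U y) ^ p * ((y \<bullet>\<^sub>U y) * tr_pow J (Suc p))"
    using nz by (intro mult_left_mono pow_le_tr_pow assms(1)) simp
  finally have "(y \<bullet>\<^sub>U y) ^ Suc p * t ^ Suc p \<le> (y \<bullet>\<^sub>U y) ^ Suc p * tr_pow J (Suc p)"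
    by (simp add: power_mult_distrib algebra_simps)
  then show ?thesis using nz by (simp only: mult_le_cancel_left_pos zero_less_power)
qed

section \<open>Binomial expansion of a rank-one update\<close>

lemma frame_op_insert:
  assumes "finite J" "x \<notin> J"
  shows "S (insert x J) y = (\<lambda>u. S J y u + (v x \<bullet>\<^sub>U y) * v x u)"
  unfolding frame_op_def using assms by (simp add: add.commute)

text \<open>The new operator factor next to the accumulated old powers is split. Products of new
  powers followed by old powers are the class of words closed under this step, which is why the
  inductions below let \<open>j\<close> vary.\<close>

lemma mixed_pow_Suc:
  assumes "finite J" "x \<notin> J"
  shows "(S (insert x J) ^^ Suc q) ((S J ^^ j) y) =
    (\<lambda>u. (S (insert x J) ^^ q) ((S J ^^ Suc j) y) u + (v x \<bullet>\<^sub>U (S J ^^ j) y) * (S (insert x J) ^^ q) (v x) u)"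
  by (simp only: funpow_Suc_right o_apply frame_op_insert[OF assms] frame_op_pow_linear)
     (simp add: funpow_swap1)

text \<open>If the old operator commuted with the rank-one term and \<open>v x\<close> had squared
  length exactly \<open>R\<close>, this would be the binomial theorem. In general each rank-one
  factor splits the form into a product of two moments, which \<open>pow_mult_le\<close> merges at
  the cost of a factor \<open>R\<close>; Pascal's rule collects the coefficients.\<close>

lemma mixed_pow_le:
  assumes fJ: "finite J" and "x \<notin> J" and R: "v x \<bullet>\<^sub>U v x \<le> R"
  defines "s \<equiv> \<lambda>p. v x \<bullet>\<^sub>U (S J ^^ p) (v x)"
  shows "v x \<bullet>\<^sub>U (S (insert x J) ^^ q) ((S J ^^ j) (v x)) \<le> (\<Sum>r\<le>q. real (q choose r) * R ^ r * s (q + j - r))"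
proof (induction q arbitrary: j)
  case 0
  show ?case by (simp add: s_def)
next
  case (Suc q)
  have snn: "0 \<le> s p" for p unfolding s_def by (rule pow_nonneg[OF fJ])
  have R0: "0 \<le> R" using R ip_nonneg[of U "v x"] by simp
  have sm: "s p * s p' \<le> R * s (p + p')" for p p'
    using pow_mult_le[OF fJ, of "v x" p p'] mult_right_mono[OF R snn[of "p + p'"]]
    unfolding s_def by linarith
  let ?f = "\<lambda>r. R ^ r * s (Suc q + j - r)"
  have "v x \<bullet>\<^sub>U (S (insert x J) ^^ Suc q) ((S J ^^ j) (v x))
      = v x \<bullet>\<^sub>U (S (insert x J) ^^ q) ((S J ^^ Suc j) (v x)) + s j * (v x \<bullet>\<^sub>U (S (insert x J) ^^ q) ((S J ^^ 0) (v x)))"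
    by (simp only: mixed_pow_Suc[OF assms(1,2)] ip_add_right ip_scale_right s_def) simp
  also have "\<dots> \<le> (\<Sum>r\<le>q. real (q choose r) * R ^ r * s (q + Suc j - r)) + s j * (\<Sum>r\<le>q. real (q choose r) * R ^ r * s (q + 0 - r))"
    by (intro add_mono mult_left_mono Suc.IH snn)
  also have "s j * (\<Sum>r\<le>q. real (q choose r) * R ^ r * s (q + 0 - r)) = (\<Sum>r\<le>q. real (q choose r) * R ^ r * (s (q - r) * s j))"
    by (simp add: sum_distrib_left algebra_simps)
  also have "(\<Sum>r\<le>q. real (q choose r) * R ^ r * (s (q - r) * s j)) \<le> (\<Sum>r\<le>q. real (q choose r) * R ^ r * (R * s (q - r + j)))"
    using R0 by (intro sum_mono mult_left_mono sm) simp
  also have "\<dots> = (\<Sum>r\<le>q. real (q choose r) * ?f (Suc r))"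
    by (intro sum.cong) (simp_all add: algebra_simps)
  also have "(\<Sum>r\<le>q. real (q choose r) * R ^ r * s (q + Suc j - r)) = (\<Sum>r\<le>q. real (q choose r) * ?f r)"
    by (simp add: algebra_simps)
  also have "(\<Sum>r\<le>q. real (q choose r) * ?f r) + (\<Sum>r\<le>q. real (q choose r) * ?f (Suc r)) = (\<Sum>r\<le>Suc q. real (Suc q choose r) * ?f r)"
  proof -
    have "(\<Sum>r\<le>Suc q. real (Suc q choose r) * ?f r) = ?f 0 + (\<Sum>r\<le>q. real (Suc q choose Suc r) * ?f (Suc r))"
      by (subst sum.atMost_Suc_shift) simp
    also have "\<dots> = ?f 0 + (\<Sum>r\<le>q. real (q choose Suc r) * ?f (Suc r)) + (\<Sum>r\<le>q. real (q choose r) * ?f (Suc r))"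
      by (simp add: sum.distrib[symmetric] algebra_simps)
    also have "?f 0 + (\<Sum>r\<le>q. real (q choose Suc r) * ?f (Suc r)) = (\<Sum>r\<le>Suc q. real (q choose r) * ?f r)"
      by (subst sum.atMost_Suc_shift) simp
    also have "\<dots> = (\<Sum>r\<le>q. real (q choose r) * ?f r)" by simp
    finally show ?thesis by simp
  qed
  finally show ?case by (simp add: algebra_simps)
qed

text \<open>The first rank-one factor split off turns the trace into a moment of \<open>v x\<close>,
  and \<open>mixed_pow_le\<close> handles the rest. Hence the coefficient
  \<open>q choose Suc r\<close> comes with only \<open>r\<close> factors \<open>R\<close>.\<close>

lemma tr_mixed_le:
  assumes fJ: "finite J" and "x \<notin> J" and R: "v x \<bullet>\<^sub>U v x \<le> R"
  defines "s \<equiv> \<lambda>p. v x \<bullet>\<^sub>U (S J ^^ p) (v x)"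
  shows "(\<Sum>u\<in>U. unit_fun u \<bullet>\<^sub>U (S (insert x J) ^^ q) ((S J ^^ j) (unit_fun u)))
    \<le> tr_pow J (q + j) + (\<Sum>r<q. real (q choose Suc r) * R ^ r * s (q + j - Suc r))"
proof (induction q arbitrary: j)
  case 0
  show ?case by (simp add: tr_pow_def)
next
  case (Suc q)
  let ?f = "\<lambda>r. R ^ r * s (q + j - r)"
  have "(\<Sum>u\<in>U. unit_fun u \<bullet>\<^sub>U (S (insert x J) ^^ Suc q) ((S J ^^ j) (unit_fun u)))
     = (\<Sum>u\<in>U. unit_fun u \<bullet>\<^sub>U (S (insert x J) ^^ q) ((S J ^^ Suc j) (unit_fun u)))
       + (\<Sum>u\<in>U. (v x \<bullet>\<^sub>U (S J ^^ j) (unit_fun u)) * (unit_fun u \<bullet>\<^sub>U (S (insert x J) ^^ q) (v x)))"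
    by (simp only: mixed_pow_Suc[OF assms(1,2)] ip_add_right ip_scale_right sum.distrib)
  \<comment> \<open>The trace of a rank-one operator is an inner product: with the old powers moved
    onto \<open>v x\<close>, Parseval sums out the basis.\<close>
  also have "(\<Sum>u\<in>U. (v x \<bullet>\<^sub>U (S J ^^ j) (unit_fun u)) * (unit_fun u \<bullet>\<^sub>U (S (insert x J) ^^ q) (v x)))
     = (\<Sum>u\<in>U. ((S J ^^ j) (v x) \<bullet>\<^sub>U unit_fun u) * (unit_fun u \<bullet>\<^sub>U (S (insert x J) ^^ q) (v x)))"
    by (simp only: frame_op_pow_self_adjoint)
  also have "\<dots> = v x \<bullet>\<^sub>U (S (insert x J) ^^ q) ((S J ^^ j) (v x))"
    unfolding parseval[symmetric] by (metis ip_commute frame_op_pow_self_adjoint)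
  also have "\<dots> \<le> (\<Sum>r\<le>q. real (q choose r) * R ^ r * s (q + j - r))"
    unfolding s_def by (rule mixed_pow_le[OF assms(1-3)])
  also note Suc.IH[of "Suc j"]
  finally have "(\<Sum>u\<in>U. unit_fun u \<bullet>\<^sub>U (S (insert x J) ^^ Suc q) ((S J ^^ j) (unit_fun u)))
    \<le> tr_pow J (Suc q + j) + ((\<Sum>r<q. real (q choose Suc r) * ?f r) + (\<Sum>r\<le>q. real (q choose r) * ?f r))"
    by (simp add: algebra_simps)
  also have "(\<Sum>r<q. real (q choose Suc r) * ?f r) = (\<Sum>r\<le>q. real (q choose Suc r) * ?f r)"
    by (simp add: lessThan_Suc_atMost[symmetric])
  also have "(\<Sum>r\<le>q. real (q choose Suc r) * ?f r) + (\<Sum>r\<le>q. real (q choose r) * ?f r) = (\<Sum>r<Suc q. real (Suc q choose Suc r) * ?f r)"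
    by (simp add: sum.distrib[symmetric] algebra_simps lessThan_Suc_atMost)
  finally show ?case by (simp add: algebra_simps)
qed

lemma tr_pow_insert_le:
  assumes "finite J" and "x \<notin> J" and "v x \<bullet>\<^sub>U v x \<le> R"
  shows "tr_pow (insert x J) p
    \<le> tr_pow J p + (\<Sum>r<p. real (p choose Suc r) * R ^ r * (v x \<bullet>\<^sub>U (S J ^^ (p - Suc r)) (v x)))"
  using tr_mixed_le[OF assms, of p 0] by (simp add: tr_pow_def)

end

section \<open>Sampling without replacement\<close>

definition ksubsets :: "'a set \<Rightarrow> nat \<Rightarrow> 'a set set" where
  "ksubsets V n = {J. J \<subseteq> V \<and> card J = n}"

lemma finite_ksubsets: "finite V \<Longrightarrow> finite (ksubsets V n)"
  unfolding ksubsets_def by simp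

lemma card_ksubsets: "finite V \<Longrightarrow> card (ksubsets V n) = card V choose n"
  unfolding ksubsets_def by (rule n_subsets)

lemma ksubsets_finite: "finite V \<Longrightarrow> J \<in> ksubsets V n \<Longrightarrow> finite J"
  unfolding ksubsets_def by (auto intro: finite_subset)

text \<open>Double counting of sets of size \<open>Suc n\<close> with a marked element, the marked
  element being the last one drawn. This is the transition from \<open>n\<close> to
  \<open>Suc n\<close> uniform draws.\<close>

lemma sum_ksubsets_insert:
  fixes F :: "'a set \<Rightarrow> real"
  assumes V: "finite V"
  shows "(\<Sum>J\<in>ksubsets V n. \<Sum>x\<in>V - J. F (insert x J)) = real (Suc n) * (\<Sum>J\<in>ksubsets V (Suc n). F J)"
proof -
  have fin: "finite J" if "J \<in> ksubsets V m" for J m by (rule ksubsets_finite[OF V that])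
  have "(\<Sum>J\<in>ksubsets V n. \<Sum>x\<in>V - J. F (insert x J)) = (\<Sum>(J, x)\<in>(SIGMA J:ksubsets V n. V - J). F (insert x J))"
    using V by (intro sum.Sigma) (auto simp: finite_ksubsets)
  also have "\<dots> = (\<Sum>(J, x)\<in>(SIGMA J:ksubsets V (Suc n). J). F J)"
  proof (rule sum.reindex_bij_witness[of _ "\<lambda>(J, x). (J - {x}, x)" "\<lambda>(J, x). (insert x J, x)"])
    fix p assume "p \<in> (SIGMA J:ksubsets V n. V - J)"
    then obtain J x where p: "p = (J, x)" "J \<in> ksubsets V n" "x \<in> V" "x \<notin> J" by auto
    then have c: "finite J" "J \<subseteq> V" "card J = n" using fin[OF p(2)] p(2) by (simp_all add: ksubsets_def)
    show "(case case p of (J, x) \<Rightarrow> (insert x J, x) of (J, x) \<Rightarrow> (J - {x}, x)) = p" using p by simp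
    show "(case p of (J, x) \<Rightarrow> (insert x J, x)) \<in> (SIGMA J:ksubsets V (Suc n). J)"
      using p c by (simp add: ksubsets_def)
    show "(case case p of (J, x) \<Rightarrow> (insert x J, x) of (J, x) \<Rightarrow> F J) = (case p of (J, x) \<Rightarrow> F (insert x J))"
      using p by simp
  next
    fix p assume "p \<in> (SIGMA J:ksubsets V (Suc n). J)"
    then obtain J x where p: "p = (J, x)" "J \<in> ksubsets V (Suc n)" "x \<in> J" by auto
    then have c: "finite J" "J \<subseteq> V" "card J = Suc n" using fin[OF p(2)] p(2) by (simp_all add: ksubsets_def)
    show "(case case p of (J, x) \<Rightarrow> (J - {x}, x) of (J, x) \<Rightarrow> (insert x J, x)) = p" using p by (simp add: insert_absorb)
    show "(case p of (J, x) \<Rightarrow> (J - {x}, x)) \<in> (SIGMA J:ksubsets V n. V - J)"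
      using p c by (auto simp: ksubsets_def)
  qed
  also have "\<dots> = (\<Sum>J\<in>ksubsets V (Suc n). \<Sum>x\<in>J. F J)"
    using V by (intro sum.Sigma[symmetric]) (simp_all add: finite_ksubsets fin)
  also have "\<dots> = (\<Sum>J\<in>ksubsets V (Suc n). real (Suc n) * F J)"
    by (intro sum.cong refl) (simp add: ksubsets_def)
  finally show ?thesis by (simp add: sum_distrib_left)
qed

lemma sum_exp_le_exp:
  fixes x :: real
  assumes "0 \<le> x"
  shows "(\<Sum>p<P. x ^ Suc p / fact (Suc p)) \<le> exp x - 1"
proof -
  have "(\<Sum>p<Suc P. x ^ p / fact p) \<le> (\<Sum>p. x ^ p / fact p)"
    using assms summable_exp[of x] by (intro sum_le_suminf) (simp_all add: field_simps)
  also have "\<dots> = exp x" by (simp add: exp_def scaleR_conv_of_real field_simps)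
  finally show ?thesis by (simp add: sum.lessThan_Suc_shift del: sum.lessThan_Suc)
qed

lemma sum_exp_tendsto:
  fixes x :: real
  shows "(\<lambda>P. \<Sum>p<P. x ^ Suc p / fact (Suc p)) \<longlonglongrightarrow> exp x - 1"
proof -
  have "(\<lambda>p. x ^ p / fact p) sums exp x" 
    using exp_converges[of x] by (simp add: scaleR_conv_of_real field_simps)
  then have "(\<lambda>p. x ^ Suc p / fact (Suc p)) sums (exp x - 1)"
    by (subst sums_Suc_iff) simp
  then show ?thesis unfolding sums_def .
qed

context finite_family begin

text \<open>Taylor polynomial of degree \<open>P\<close> of the trace of
  \<open>exp (\<tau> S) - Id\<close>. Without the zeroth power the empty sample has value 0 in every
  dimension.\<close>

definition "tr_exp P \<tau> J = (\<Sum>p<P. \<tau> ^ Suc p / fact (Suc p) * tr_pow J (Suc p))"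

lemma tr_exp_nonneg: "finite J \<Longrightarrow> 0 \<le> \<tau> \<Longrightarrow> 0 \<le> tr_exp P \<tau> J"
  unfolding tr_exp_def by (intro sum_nonneg mult_nonneg_nonneg tr_pow_nonneg) auto

text \<open>A truncated, rank-one form of the Golden-Thompson inequality
  \<open>tr e\<^bsup>S + x x\<^sup>T\<^esup> \<le> tr (e\<^bsup>S\<^esup> e\<^bsup>x x\<^sup>T\<^esup>)\<close>.\<close>
lemma tr_exp_insert_le:
  assumes fJ: "finite J" and "x \<notin> J" and R: "v x \<bullet>\<^sub>U v x \<le> R" "0 < R" and \<tau>: "0 \<le> \<tau>"
  shows "tr_exp P \<tau> (insert x J)
    \<le> tr_exp P \<tau> J + (exp (\<tau> * R) - 1) / R * (\<Sum>q<P. \<tau> ^ q / fact q * (v x \<bullet>\<^sub>U (S J ^^ q) (v x)))"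
proof -
  define f where "f r = \<tau> ^ Suc r * R ^ r / fact (Suc r)" for r
  define g where "g q = \<tau> ^ q / fact q * (v x \<bullet>\<^sub>U (S J ^^ q) (v x))" for q
  have g0: "0 \<le> g q" for q unfolding g_def using \<tau> pow_nonneg[OF fJ] by simp
  have f0: "0 \<le> f q" for q unfolding f_def using \<tau> R by simp
  have conv: "\<tau> ^ Suc p / fact (Suc p) * (real (Suc p choose Suc r) * R ^ r * (v x \<bullet>\<^sub>U (S J ^^ (Suc p - Suc r)) (v x)))
      = f r * g (p - r)" if "r \<le> p" for p r
  proof -
    have b: "real (Suc p choose Suc r) = fact (Suc p) / (fact (Suc r) * fact (p - r))"
      using binomial_fact[of "Suc r" "Suc p"] that by simp
    have "\<tau> ^ Suc p = \<tau> ^ Suc r * \<tau> ^ (p - r)" using that by (simp add: power_add[symmetric])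
    then show ?thesis unfolding b f_def g_def by (simp del: fact_Suc power_Suc)
  qed
  have "tr_exp P \<tau> (insert x J) \<le> (\<Sum>p<P. \<tau> ^ Suc p / fact (Suc p) * (tr_pow J (Suc p)
     + (\<Sum>r<Suc p. real (Suc p choose Suc r) * R ^ r * (v x \<bullet>\<^sub>U (S J ^^ (Suc p - Suc r)) (v x)))))"
    unfolding tr_exp_def
    by (intro sum_mono mult_left_mono tr_pow_insert_le[OF fJ assms(2) R(1)]) (use \<tau> in simp)
  also have "\<dots> = tr_exp P \<tau> J + (\<Sum>p<P. \<Sum>r\<le>p. f r * g (p - r))"
    unfolding tr_exp_def distrib_left sum.distrib sum_distrib_left lessThan_Suc_atMost
    by (intro arg_cong2[of _ _ _ _ "(+)"] refl sum.cong conv) simp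
  also have "(\<Sum>p<P. \<Sum>r\<le>p. f r * g (p - r)) = (\<Sum>(r, q)\<in>{(r, q). r + q < P}. f r * g q)"
    by (rule sum.triangle_reindex[symmetric])
  \<comment> \<open>Enlarging the triangle to a square adds only nonnegative terms and makes the
    double sum factor; the factor in \<open>r\<close> is then bounded by the full exponential
    series.\<close>
  also have "\<dots> \<le> (\<Sum>(r, q)\<in>{..<P} \<times> {..<P}. f r * g q)"
    by (intro sum_mono2) (auto simp: f0 g0)
  also have "\<dots> = (\<Sum>r<P. f r) * (\<Sum>q<P. g q)"
    by (simp add: sum_product sum.cartesian_product)
  also have "\<dots> \<le> ((exp (\<tau> * R) - 1) / R) * (\<Sum>q<P. g q)"
  proof (intro mult_right_mono sum_nonneg g0)
    have "R * (\<Sum>r<P. f r) = (\<Sum>r<P. (\<tau> * R) ^ Suc r / fact (Suc r))"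
      unfolding f_def sum_distrib_left by (intro sum.cong refl) (simp add: power_mult_distrib)
    also have "\<dots> \<le> exp (\<tau> * R) - 1" using \<tau> R by (intro sum_exp_le_exp) simp
    finally show "(\<Sum>r<P. f r) \<le> (exp (\<tau> * R) - 1) / R" using R by (simp add: field_simps)
  qed
  finally show ?thesis unfolding g_def by simp
qed

text \<open>The term \<open>q = 0\<close> contributes squared lengths, at most \<open>R\<close>
  each. The other terms are summed against the operator bound \<Lambda>, which is inherited by the
  indices outside \<open>J\<close> because squares are dropped.\<close>

lemma sum_exp_form_le:
  assumes V: "finite V" and J: "finite J" and R: "\<And>x. x \<in> V \<Longrightarrow> v x \<bullet>\<^sub>U v x \<le> R"
    and \<Lambda>: "\<And>y. (\<Sum>x\<in>V. (v x \<bullet>\<^sub>U y)\<^sup>2) \<le> \<Lambda> * (y \<bullet>\<^sub>U y)" and \<tau>: "0 \<le> \<tau>"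
  shows "(\<Sum>x\<in>V - J. \<Sum>q<P. \<tau> ^ q / fact q * (v x \<bullet>\<^sub>U (S J ^^ q) (v x)))
    \<le> \<Lambda> * tr_exp P \<tau> J + real (card (V - J)) * R"
proof -
  have \<Lambda>': "(\<Sum>x\<in>V - J. (v x \<bullet>\<^sub>U y)\<^sup>2) \<le> \<Lambda> * (y \<bullet>\<^sub>U y)" for y
    using sum_mono2[OF V, of "V - J" "\<lambda>x. (v x \<bullet>\<^sub>U y)\<^sup>2"] \<Lambda>[of y] by force
  \<comment> \<open>One more Taylor term is added so that exactly the \<open>P\<close> terms of
    \<open>tr_exp\<close> remain after \<open>q = 0\<close> is split off.\<close>
  have "(\<Sum>x\<in>V - J. \<Sum>q<P. \<tau> ^ q / fact q * (v x \<bullet>\<^sub>U (S J ^^ q) (v x)))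
     \<le> (\<Sum>x\<in>V - J. \<Sum>q<Suc P. \<tau> ^ q / fact q * (v x \<bullet>\<^sub>U (S J ^^ q) (v x)))"
    by (intro sum_mono sum_mono2) (use \<tau> pow_nonneg[OF J] in auto)
  also have "\<dots> = (\<Sum>x\<in>V - J. v x \<bullet>\<^sub>U v x)
      + (\<Sum>q<P. \<tau> ^ Suc q / fact (Suc q) * (\<Sum>x\<in>V - J. v x \<bullet>\<^sub>U (S J ^^ Suc q) (v x)))"
    unfolding sum.lessThan_Suc_shift sum.distrib sum_distrib_left
    by (subst sum.swap) simp
  also have "\<dots> \<le> real (card (V - J)) * R + (\<Sum>q<P. \<tau> ^ Suc q / fact (Suc q) * (\<Lambda> * tr_pow J (Suc q)))"
    using \<tau> R by (intro add_mono sum_mono mult_left_mono sum_pow_le_tr_pow J \<Lambda>' sum_bounded_above) auto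
  also have "(\<Sum>q<P. \<tau> ^ Suc q / fact (Suc q) * (\<Lambda> * tr_pow J (Suc q))) = \<Lambda> * tr_exp P \<tau> J"
    unfolding tr_exp_def sum_distrib_left by (intro sum.cong refl) simp
  finally show ?thesis by simp
qed

text \<open>On average, one more draw multiplies the trace by at most
  \<open>1 + g / R * (\<Lambda> / K)\<close> and adds at most \<open>g\<close>; the right-hand side
  solves this recursion from the value 0. The draw that completes an \<open>n\<close>-subset has
  \<open>card V - n + 1\<close> candidates, hence the condition on \<open>K\<close>.\<close>

lemma sum_tr_exp_le:
  assumes V: "finite V" and R: "\<And>x. x \<in> V \<Longrightarrow> v x \<bullet>\<^sub>U v x \<le> R" "0 < R"
    and \<Lambda>: "\<And>y. (\<Sum>x\<in>V. (v x \<bullet>\<^sub>U y)\<^sup>2) \<le> \<Lambda> * (y \<bullet>\<^sub>U y)" "0 \<le> \<Lambda>" and \<tau>: "0 \<le> \<tau>"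
    and K: "0 < K"
  defines "g \<equiv> exp (\<tau> * R) - 1"
  shows "K + real n \<le> real (card V) + 1 \<Longrightarrow>
    (\<Sum>J\<in>ksubsets V n. tr_exp P \<tau> J) \<le> real (card V choose n) * (real n * g * exp (real n * g * (\<Lambda> / K) / R))"
proof (induction n)
  case 0
  have [simp]: "frame_op U v {} = (\<lambda>y u. 0)" unfolding frame_op_def by (intro ext) simp
  have "ksubsets V 0 = {{}}" using V by (auto simp: ksubsets_def dest: finite_subset)
  moreover have "tr_exp P \<tau> {} = 0" unfolding tr_exp_def tr_pow_def by (simp add: ip_def)
  ultimately show ?case by simp
next
  case (Suc n)
  let ?M = "real (card V)"
  define D where "D = ?M - real n"
  have D: "K \<le> D" "0 < D" using Suc.prems K unfolding D_def by auto
  have g0: "0 \<le> g" unfolding g_def using \<tau> R by simp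
  define E where "E m = exp (real m * g * (\<Lambda> / K) / R)" for m
  have h0: "0 \<le> g / R * (\<Lambda> / K)" using g0 R \<Lambda>(2) K by simp
  have E1: "1 \<le> E m" for m unfolding E_def using g0 R \<Lambda>(2) K by simp
  have ES: "(1 + g / R * (\<Lambda> / K)) * E n \<le> E (Suc n)"
  proof -
    have "E (Suc n) = exp (g / R * (\<Lambda> / K)) * E n"
      unfolding E_def by (subst exp_add[symmetric]) (simp add: algebra_simps add_divide_distrib)
    moreover have "1 + g / R * (\<Lambda> / K) \<le> exp (g / R * (\<Lambda> / K))" by (rule exp_ge_add_one_self)
    ultimately show ?thesis using E1[of n] by (simp add: mult_right_mono)
  qed
  have nM: "n < card V" using D unfolding D_def by simp
  have IH: "(\<Sum>J\<in>ksubsets V n. tr_exp P \<tau> J) \<le> real (card V choose n) * (real n * g * E n)"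
    unfolding E_def using Suc.IH Suc.prems by simp
  have cD: "real (card (V - J)) = D" if "J \<in> ksubsets V n" for J
    using that V nM unfolding ksubsets_def D_def by (auto simp: card_Diff_subset finite_subset of_nat_diff)
  have step: "(\<Sum>x\<in>V - J. tr_exp P \<tau> (insert x J)) \<le> D * (1 + g / R * (\<Lambda> / K)) * tr_exp P \<tau> J + D * g"
    if J: "J \<in> ksubsets V n" for J
  proof -
    have fJ: "finite J" using ksubsets_finite[OF V J] .
    have "(\<Sum>x\<in>V - J. tr_exp P \<tau> (insert x J)) \<le> (\<Sum>x\<in>V - J. tr_exp P \<tau> J + g / R * (\<Sum>q<P. \<tau> ^ q / fact q * (v x \<bullet>\<^sub>U (S J ^^ q) (v x))))"
      unfolding g_def by (intro sum_mono tr_exp_insert_le fJ R \<tau>) auto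
    also have "\<dots> = D * tr_exp P \<tau> J + g / R * (\<Sum>x\<in>V - J. \<Sum>q<P. \<tau> ^ q / fact q * (v x \<bullet>\<^sub>U (S J ^^ q) (v x)))"
      by (simp add: sum.distrib sum_distrib_left cD[OF J])
    also have "\<dots> \<le> D * tr_exp P \<tau> J + g / R * (\<Lambda> * tr_exp P \<tau> J + D * R)"
      using sum_exp_form_le[OF V fJ R(1) \<Lambda>(1) \<tau>, of P] g0 R(2)
      by (intro add_left_mono mult_left_mono) (simp_all add: cD[OF J])
    also have "\<dots> = D * tr_exp P \<tau> J + D * (g / R * (\<Lambda> / D)) * tr_exp P \<tau> J + D * g"
      using R(2) D by (simp add: field_simps)
    also have "\<dots> \<le> D * tr_exp P \<tau> J + D * (g / R * (\<Lambda> / K)) * tr_exp P \<tau> J + D * g"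
      using D K \<Lambda>(2) g0 R(2) tr_exp_nonneg[OF fJ \<tau>]
      by (intro add_right_mono add_left_mono mult_right_mono mult_left_mono divide_left_mono) auto
    finally show ?thesis by (simp add: algebra_simps)
  qed
  have ch: "real (Suc n) * real (card V choose Suc n) = D * real (card V choose n)"
  proof -
    have "Suc n * (card V choose Suc n) = (card V - n) * (card V choose n)"
      using binomial_absorb_comp[of "card V" n] Suc_times_binomial_eq[of "card V - 1" n] nM
      by (metis Suc_diff_1 binomial_absorption gr_implies_not0 mult.commute neq0_conv)
    then have "real (Suc n) * real (card V choose Suc n) = real (card V - n) * real (card V choose n)"
      by (metis of_nat_mult)
    then show ?thesis using nM by (simp add: D_def of_nat_diff)
  qed
  have "real (Suc n) * (\<Sum>J\<in>ksubsets V (Suc n). tr_exp P \<tau> J) = (\<Sum>J\<in>ksubsets V n. \<Sum>x\<in>V - J. tr_exp P \<tau> (insert x J))"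
    by (rule sum_ksubsets_insert[OF V, symmetric])
  also have "\<dots> \<le> (\<Sum>J\<in>ksubsets V n. D * (1 + g / R * (\<Lambda> / K)) * tr_exp P \<tau> J + D * g)"
    by (intro sum_mono step)
  also have "\<dots> = D * ((1 + g / R * (\<Lambda> / K)) * (\<Sum>J\<in>ksubsets V n. tr_exp P \<tau> J) + real (card V choose n) * g)"
    by (simp add: sum.distrib sum_distrib_left card_ksubsets[OF V] algebra_simps)
  also have "\<dots> \<le> D * ((1 + g / R * (\<Lambda> / K)) * (real (card V choose n) * (real n * g * E n)) + real (card V choose n) * g)"
    using h0 D by (intro mult_left_mono add_right_mono IH) auto
  also have "\<dots> = D * real (card V choose n) * g * (real n * ((1 + g / R * (\<Lambda> / K)) * E n) + 1)"
    by (simp add: algebra_simps)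
  \<comment> \<open>The additive term of the recursion is absorbed as one further copy of
    \<open>E (Suc n)\<close>, which is at least 1.\<close>
  also have "\<dots> \<le> D * real (card V choose n) * g * (real n * E (Suc n) + E (Suc n))"
    using D g0 E1[of "Suc n"] by (intro mult_left_mono add_mono ES) auto
  also have "\<dots> = real (Suc n) * (real (card V choose Suc n) * (real (Suc n) * g * E (Suc n)))"
    unfolding ch[symmetric] by (simp add: algebra_simps)
  finally show ?case unfolding E_def by (simp only: mult_le_cancel_left_pos of_nat_0_less_iff zero_less_Suc)
qed

text \<open>Markov's inequality for \<open>tr_exp\<close>, at every truncation \<open>P\<close>. The
  right-hand side does not depend on \<open>P\<close>, so the limit is taken only in the scalar
  factor on the left.\<close>

theorem sampling_Chernoff:
  assumes V: "finite V" and R: "\<And>x. x \<in> V \<Longrightarrow> v x \<bullet>\<^sub>U v x \<le> R" "0 < R"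
    and \<Lambda>: "\<And>y. (\<Sum>x\<in>V. (v x \<bullet>\<^sub>U y)\<^sup>2) \<le> \<Lambda> * (y \<bullet>\<^sub>U y)" "0 \<le> \<Lambda>" and \<tau>: "0 \<le> \<tau>"
    and K: "0 < K" "K + real n \<le> real (card V) + 1" and t: "0 \<le> t"
  shows "real (card {J \<in> ksubsets V n. \<exists>y. t * (y \<bullet>\<^sub>U y) < (\<Sum>j\<in>J. (v j \<bullet>\<^sub>U y)\<^sup>2)}) * (exp (\<tau> * t) - 1)
    \<le> real (card V choose n) * (real n * (exp (\<tau> * R) - 1) * exp (real n * (exp (\<tau> * R) - 1) * (\<Lambda> / K) / R))"
    (is "real (card ?B) * _ \<le> ?C")
proof (rule LIMSEQ_le_const2)
  show "(\<lambda>P. real (card ?B) * (\<Sum>p<P. (\<tau> * t) ^ Suc p / fact (Suc p))) \<longlonglongrightarrow> real (card ?B) * (exp (\<tau> * t) - 1)"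
    by (intro tendsto_mult_left sum_exp_tendsto)
  show "\<exists>N. \<forall>P\<ge>N. real (card ?B) * (\<Sum>p<P. (\<tau> * t) ^ Suc p / fact (Suc p)) \<le> ?C"
  proof (intro exI[of _ 0] allI impI)
    fix P :: nat
    have fB: "?B \<subseteq> ksubsets V n" by auto
    have fin: "finite J" if "J \<in> ksubsets V n" for J by (rule ksubsets_finite[OF V that])
    have "(\<Sum>p<P. (\<tau> * t) ^ Suc p / fact (Suc p)) \<le> tr_exp P \<tau> J" if J: "J \<in> ?B" for J
    proof -
      have fJ: "finite J" using fin J by auto
      obtain y where "t * (y \<bullet>\<^sub>U y) < (\<Sum>j\<in>J. (v j \<bullet>\<^sub>U y)\<^sup>2)" using J by auto
      then have "t * (y \<bullet>\<^sub>U y) < y \<bullet>\<^sub>U S J y"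
        by (simp add: ip_frame_op power2_eq_square ip_commute)
      then have "t ^ Suc p \<le> tr_pow J (Suc p)" for p by (rule tr_pow_ge[OF fJ _ t])
      then have "\<tau> ^ Suc p / fact (Suc p) * t ^ Suc p \<le> \<tau> ^ Suc p / fact (Suc p) * tr_pow J (Suc p)" for p
        using \<tau> by (intro mult_left_mono) auto
      then show ?thesis unfolding tr_exp_def
        by (intro sum_mono) (simp add: power_mult_distrib algebra_simps)
    qed
    then have "real (card ?B) * (\<Sum>p<P. (\<tau> * t) ^ Suc p / fact (Suc p)) \<le> (\<Sum>J\<in>?B. tr_exp P \<tau> J)"
      by (rule sum_bounded_below)
    also have "\<dots> \<le> (\<Sum>J\<in>ksubsets V n. tr_exp P \<tau> J)"
      using V fin \<tau> by (intro sum_mono2 finite_ksubsets fB tr_exp_nonneg) auto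
    also have "\<dots> \<le> ?C" by (rule sum_tr_exp_le[OF V R \<Lambda> \<tau> K])
    finally show "real (card ?B) * (\<Sum>p<P. (\<tau> * t) ^ Suc p / fact (Suc p)) \<le> ?C" .
  qed
qed

end

section \<open>Random blocks\<close>

text \<open>The choice \<open>\<tau> = 1 / R\<close> and \<open>exp 1 - 1 \<le> 2\<close>: the part
  \<open>2 * n * (\<Lambda> / K)\<close> of the threshold absorbs the mean, and the excess
  \<open>s\<close>, in units of \<open>R\<close>, gives the decay.\<close>

lemma (in finite_family) sampling_tail:
  assumes V: "finite V" and R: "\<And>x. x \<in> V \<Longrightarrow> v x \<bullet>\<^sub>U v x \<le> R" "0 < R"
    and \<Lambda>: "\<And>y. (\<Sum>x\<in>V. (v x \<bullet>\<^sub>U y)\<^sup>2) \<le> \<Lambda> * (y \<bullet>\<^sub>U y)" "0 \<le> \<Lambda>"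
    and K: "0 < K" "K + real n \<le> real (card V) + 1"
    and t: "2 * real n * (\<Lambda> / K) + s * R \<le> t" and s: "1 \<le> s"
  shows "real (card {J \<in> ksubsets V n. \<exists>y. t * (y \<bullet>\<^sub>U y) < (\<Sum>j\<in>J. (v j \<bullet>\<^sub>U y)\<^sup>2)})
    \<le> real (card V choose n) * (real n * exp (1 - s))" (is "?c \<le> ?b * _")
proof -
  define e where "e = exp (1 :: real)"
  have e: "1 < e" "e \<le> 3" unfolding e_def using exp_le by auto
  define \<nu> where "\<nu> = real n * (\<Lambda> / K)"
  have \<nu>: "0 \<le> \<nu>" unfolding \<nu>_def using \<Lambda>(2) K(1) by simp
  have tR: "2 * \<nu> / R + s \<le> t / R" 
    using divide_right_mono[OF t, of R] R(2) unfolding \<nu>_def by (simp add: add_divide_distrib mult.assoc)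
  have "0 \<le> s * R" using s R(2) by simp
  then have t0: "0 \<le> t" using t \<nu> unfolding \<nu>_def by linarith
  have "?c * (exp (1 / R * t) - 1) \<le> ?b * (real n * (exp (1 / R * R) - 1) * exp (real n * (exp (1 / R * R) - 1) * (\<Lambda> / K) / R))"
    using R(2) by (intro sampling_Chernoff V R \<Lambda> K t0) auto
  then have c: "?c * (exp (t / R) - 1) \<le> ?b * real n * ((e - 1) * exp ((e - 1) * \<nu> / R))"
    using R(2) unfolding \<nu>_def e_def by (simp add: mult_ac)
  have "(e - 1) * \<nu> / R \<le> 2 * \<nu> / R"
    using e \<nu> R(2) by (intro divide_right_mono mult_right_mono) auto
  then have "exp ((e - 1) * \<nu> / R) \<le> exp (t / R) * exp (- s)"
    unfolding exp_add[symmetric] using tR by simp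
  then have r: "?b * real n * ((e - 1) * exp ((e - 1) * \<nu> / R)) \<le> ?b * real n * ((e - 1) * (exp (t / R) * exp (- s)))"
    using e by (intro mult_left_mono) auto
  have "0 \<le> 2 * \<nu> / R" using \<nu> R(2) by simp
  then have "1 \<le> t / R" using tR s by linarith
  then have "e \<le> exp (t / R)" unfolding e_def by simp
  \<comment> \<open>Markov divides by \<open>exp (t / R) - 1\<close>, as the identity was
    subtracted. Since \<open>1 \<le> t / R\<close> this loses only \<open>e / (e - 1)\<close>, and
    the \<open>e - 1\<close> cancels against the one from the update.\<close>
  then have "(e - 1) * exp (t / R) \<le> e * (exp (t / R) - 1)" by (simp add: algebra_simps)
  then have "?c * ((e - 1) * exp (t / R)) \<le> ?c * (e * (exp (t / R) - 1))" by (intro mult_left_mono) auto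
  also have "\<dots> \<le> e * (?b * real n * ((e - 1) * (exp (t / R) * exp (- s))))"
    using c r e by simp
  finally have "(?c) * ((e - 1) * exp (t / R)) \<le> (?b * real n * (e * exp (- s))) * ((e - 1) * exp (t / R))"
    by (simp add: mult_ac)
  then have "?c \<le> ?b * real n * (e * exp (- s))"
    using e by (simp add: mult_le_cancel_right)
  also have "e * exp (- s) = exp (1 - s)" unfolding e_def exp_add[symmetric] by simp
  finally show ?thesis by (simp add: mult.assoc)
qed

text \<open>Here \<open>t\<close> bounds the square of the operator norm of a block, the quantity
  that the Chernoff bound controls. Entries are a function of all index pairs, so passing to a block
  changes only the index sets.\<close>

definition block_bound :: "('i \<Rightarrow> 'j \<Rightarrow> real) \<Rightarrow> real \<Rightarrow> 'i set \<Rightarrow> 'j set \<Rightarrow> bool" where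
  "block_bound h t A J \<longleftrightarrow> (\<forall>y. (\<Sum>i\<in>A. (ip J (h i) y)\<^sup>2) \<le> t * ip J y y)"

text \<open>Duality: testing the transposed bound on the image of \<open>z\<close> gives
  \<open>X\<^sup>2\<close> at most \<open>t * ip J z z * X\<close>, and one factor \<open>X\<close>
  cancels.\<close>

lemma block_bound_transpose:
  assumes sym: "\<And>i j. h i j = h' j i"
    and b: "\<And>y. (\<Sum>j\<in>J. (ip A (h' j) y)\<^sup>2) \<le> t * ip A y y" and t: "0 \<le> t"
  shows "block_bound h t A J"
  unfolding block_bound_def
proof
  fix z
  define y where "y i = ip J (h i) z" for i
  define X where "X = (\<Sum>i\<in>A. (ip J (h i) z)\<^sup>2)"
  have X: "X = ip A y y" unfolding X_def y_def ip_def by (simp add: power2_eq_square)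
  have X0: "0 \<le> X" unfolding X by (rule ip_nonneg)
  have "X = (\<Sum>i\<in>A. y i * (\<Sum>j\<in>J. h i j * z j))" unfolding X ip_def y_def ..
  also have "\<dots> = (\<Sum>j\<in>J. z j * ip A (h' j) y)"
    unfolding ip_def sum_distrib_left by (subst sum.swap) (simp add: sym mult_ac)
  finally have "X\<^sup>2 = (\<Sum>j\<in>J. z j * ip A (h' j) y)\<^sup>2" by simp
  also have "\<dots> \<le> (\<Sum>j\<in>J. (z j)\<^sup>2) * (\<Sum>j\<in>J. (ip A (h' j) y)\<^sup>2)" by (rule Cauchy_Schwarz_ineq_sum)
  also have "\<dots> \<le> ip J z z * (t * X)"
    unfolding X using b[of y] by (intro mult_mono) (auto simp: ip_def power2_eq_square sum_nonneg)
  finally have "X * X \<le> (t * ip J z z) * X" by (simp add: power2_eq_square mult_ac)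
  then have "X \<le> t * ip J z z"
    using X0 t ip_nonneg[of J z] by (cases "X = 0") (auto simp: mult_le_cancel_right)
  then show "(\<Sum>i\<in>A. (ip J (h i) z)\<^sup>2) \<le> t * ip J z z" unfolding X_def .
qed

text \<open>The rank-one summands are the columns \<open>h j\<close>, as vectors indexed by
  \<open>V\<close>. Their frame operator is the block times its transpose and tests vectors on the
  row side, so the outcome is transposed at the end.\<close>

lemma column_sampling_tail:
  fixes h :: "'i \<Rightarrow> 'i \<Rightarrow> real"
  assumes V: "finite V" and sym: "\<And>i j. h i j = h j i"
    and \<rho>: "\<And>i. i \<in> V \<Longrightarrow> ip V (h i) (h i) \<le> \<rho>" "0 < \<rho>"
    and \<Lambda>: "block_bound h \<Lambda> V V" "0 \<le> \<Lambda>"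
    and K: "0 < K" "K + real n \<le> real (card V) + 1"
    and t: "2 * real n * (\<Lambda> / K) + s * \<rho> \<le> t" and s: "1 \<le> s"
  shows "real (card {J \<in> ksubsets V n. \<not> block_bound h t V J}) \<le> real (card V choose n) * (real n * exp (1 - s))"
proof -
  interpret finite_family V h by standard (rule V)
  have "0 \<le> 2 * real n * (\<Lambda> / K)" "0 \<le> s * \<rho>" using \<Lambda>(2) K(1) s \<rho>(2) by simp_all
  then have t0: "0 \<le> t" using t by linarith
  have "real (card {J \<in> ksubsets V n. \<not> block_bound h t V J})
    \<le> real (card {J \<in> ksubsets V n. \<exists>y. t * ip V y y < (\<Sum>j\<in>J. (ip V (h j) y)\<^sup>2)})"
  proof (intro of_nat_mono card_mono)
    have "block_bound h t V J" if "\<And>y. (\<Sum>j\<in>J. (ip V (h j) y)\<^sup>2) \<le> t * ip V y y" for J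
      by (rule block_bound_transpose[OF sym that t0])
    then show "{J \<in> ksubsets V n. \<not> block_bound h t V J}
      \<subseteq> {J \<in> ksubsets V n. \<exists>y. t * ip V y y < (\<Sum>j\<in>J. (ip V (h j) y)\<^sup>2)}"
      using not_less by blast
  qed (simp add: finite_ksubsets[OF V])
  also have "\<dots> \<le> real (card V choose n) * (real n * exp (1 - s))"
    using \<Lambda>(1) unfolding block_bound_def by (intro sampling_tail[OF V \<rho> _ \<Lambda>(2) K t s]) auto
  finally show ?thesis .
qed

text \<open>Truncation: rows of squared norm above \<open>B\<close> become 0, so the length
  hypothesis holds for every index while the operator bound survives. If all rows in
  \<open>A\<close> are short, the truncated block is the original one.\<close>

lemma row_sampling_tail:
  fixes h :: "'i \<Rightarrow> 'i \<Rightarrow> real"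
  assumes V: "finite V" and J: "J \<subseteq> V" and B: "0 < B"
    and \<Lambda>: "block_bound h \<Lambda> V J" "0 \<le> \<Lambda>"
    and K: "0 < K" "K + real n \<le> real (card (V - J)) + 1"
    and t: "2 * real n * (\<Lambda> / K) + s * B \<le> t" and s: "1 \<le> s"
  shows "real (card {A \<in> ksubsets (V - J) n. (\<forall>i\<in>A. ip J (h i) (h i) \<le> B) \<and> \<not> block_bound h t A J})
    \<le> real (card (V - J) choose n) * (real n * exp (1 - s))"
proof -
  define v where "v i j = (if ip J (h i) (h i) \<le> B then h i j else 0)" for i j
  interpret finite_family J v by standard (rule finite_subset[OF J V])
  have v: "v i = (if ip J (h i) (h i) \<le> B then h i else (\<lambda>_. 0))" for i unfolding v_def by auto
  have z: "ip J (\<lambda>_. 0) y = 0" for y by (simp add: ip_def)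
  have "(\<Sum>i\<in>V - J. (ip J (v i) y)\<^sup>2) \<le> \<Lambda> * ip J y y" for y
  proof -
    have "(\<Sum>i\<in>V - J. (ip J (v i) y)\<^sup>2) \<le> (\<Sum>i\<in>V - J. (ip J (h i) y)\<^sup>2)"
      by (intro sum_mono) (simp add: v z)
    also have "\<dots> \<le> (\<Sum>i\<in>V. (ip J (h i) y)\<^sup>2)" using V by (intro sum_mono2) auto
    also have "\<dots> \<le> \<Lambda> * ip J y y" using \<Lambda>(1) unfolding block_bound_def by blast
    finally show ?thesis .
  qed
  then have "real (card {A \<in> ksubsets (V - J) n. \<exists>y. t * ip J y y < (\<Sum>i\<in>A. (ip J (v i) y)\<^sup>2)})
     \<le> real (card (V - J) choose n) * (real n * exp (1 - s))"
    using V B by (intro sampling_tail[OF _ _ B _ \<Lambda>(2) K t s]) (auto simp: v z)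
  moreover have "real (card {A \<in> ksubsets (V - J) n. (\<forall>i\<in>A. ip J (h i) (h i) \<le> B) \<and> \<not> block_bound h t A J})
    \<le> real (card {A \<in> ksubsets (V - J) n. \<exists>y. t * ip J y y < (\<Sum>i\<in>A. (ip J (v i) y)\<^sup>2)})"
    by (intro of_nat_mono card_mono) (use V in \<open>auto simp: finite_ksubsets block_bound_def not_le v\<close>)
  ultimately show ?thesis by linarith
qed

text \<open>The matrix bound in dimension one, over the index set \<open>unit\<close>. Row
  \<open>i\<close> is used only when \<open>i\<close> lies outside \<open>J\<close>, so the sampling
  is from \<open>V - {i}\<close>; the lost element removes the \<open>+ 1\<close> from the condition
  on \<open>K\<close>.\<close>

lemma row_norm_Chernoff:
  fixes h :: "'i \<Rightarrow> 'i \<Rightarrow> real"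
  assumes V: "finite V" and i: "i \<in> V"
    and \<rho>: "ip V (h i) (h i) \<le> \<rho>" "0 \<le> \<rho>"
    and \<mu>: "\<And>j. j \<in> V \<Longrightarrow> j \<noteq> i \<Longrightarrow> (h i j)\<^sup>2 \<le> R" "0 < R"
    and K: "0 < K" "K + real n \<le> real (card V)" and t: "0 \<le> t" and \<tau>: "0 \<le> \<tau>"
  shows "real (card {J \<in> ksubsets (V - {i}) n. t < ip J (h i) (h i)}) * (exp (\<tau> * t) - 1)
    \<le> real ((card V - 1) choose n) * (real n * (exp (\<tau> * R) - 1) * exp (real n * (exp (\<tau> * R) - 1) * (\<rho> / K) / R))"
proof -
  define v :: "'i \<Rightarrow> unit \<Rightarrow> real" where "v j = (\<lambda>_. h i j)" for j
  interpret finite_family "UNIV :: unit set" v by standard simp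
  have ip1: "ip UNIV (v j) y = h i j * y ()" "ip UNIV y y = (y ())\<^sup>2" for j and y :: "unit \<Rightarrow> real"
    unfolding ip_def v_def by (simp_all add: UNIV_unit power2_eq_square)
  have sq: "(\<Sum>j\<in>J. (ip UNIV (v j) y)\<^sup>2) = ip J (h i) (h i) * (y ())\<^sup>2" for J and y :: "unit \<Rightarrow> real"
    unfolding ip1 ip_def[of J] sum_distrib_right by (simp add: power2_eq_square mult_ac)
  have c: "card (V - {i}) = card V - 1" "card V \<ge> 1"
    using V i card_gt_0_iff[of V] by auto
  have "ip (V - {i}) (h i) (h i) \<le> ip V (h i) (h i)" unfolding ip_def using V by (intro sum_mono2) auto
  then have b: "ip (V - {i}) (h i) (h i) \<le> \<rho>" using \<rho> by simp
  have "real (card {J \<in> ksubsets (V - {i}) n. \<exists>y. t * ip UNIV y y < (\<Sum>j\<in>J. (ip UNIV (v j) y)\<^sup>2)}) * (exp (\<tau> * t) - 1)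
    \<le> real (card (V - {i}) choose n) * (real n * (exp (\<tau> * R) - 1) * exp (real n * (exp (\<tau> * R) - 1) * (\<rho> / K) / R))"
  proof (intro sampling_Chernoff \<mu>(2) \<rho>(2) \<tau> K(1) t)
    show "K + real n \<le> real (card (V - {i})) + 1" using K c by (simp add: of_nat_diff)
    show "ip UNIV (v x) (v x) \<le> R" if "x \<in> V - {i}" for x
      using \<mu>(1)[of x] that unfolding ip_def v_def by (simp add: UNIV_unit power2_eq_square)
    show "(\<Sum>x\<in>V - {i}. (ip UNIV (v x) y)\<^sup>2) \<le> \<rho> * ip UNIV y y" for y
      unfolding sq ip1(2) using b by (intro mult_right_mono) auto
  qed (use V in simp)
  also have "{J \<in> ksubsets (V - {i}) n. \<exists>y. t * ip UNIV y y < (\<Sum>j\<in>J. (ip UNIV (v j) y)\<^sup>2)}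
     = {J \<in> ksubsets (V - {i}) n. t < ip J (h i) (h i)}"
  proof -
    have "(\<exists>y :: unit \<Rightarrow> real. t * ip UNIV y y < (\<Sum>j\<in>J. (ip UNIV (v j) y)\<^sup>2)) \<longleftrightarrow> t < ip J (h i) (h i)" for J
      unfolding sq ip1(2)
      by (auto simp: mult_less_cancel_right not_less intro!: exI[of _ "\<lambda>_. 1"])
    then show ?thesis by simp
  qed
  finally show ?thesis unfolding c .
qed

section \<open>Union bound for a random pair of disjoint sets\<close>

lemma sum_card_filter:
  assumes "finite A" "finite B"
  shows "(\<Sum>x\<in>A. card {y \<in> B. P x y}) = (\<Sum>y\<in>B. card {x \<in> A. P x y})"
proof -
  have "(\<Sum>x\<in>A. card {y \<in> B. P x y}) = (\<Sum>x\<in>A. \<Sum>y\<in>B. of_bool (P x y))"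
    using assms by (simp add: sum_of_bool_eq Int_def)
  also have "\<dots> = (\<Sum>y\<in>B. card {x \<in> A. P x y})"
    using assms by (subst sum.swap) (simp add: sum_of_bool_eq Int_def)
  finally show ?thesis .
qed

lemma card_ksubsets_containing:
  assumes V: "finite V" and i: "i \<in> V"
  shows "card {A \<in> ksubsets V (Suc n). i \<in> A} = (card V - 1) choose n"
proof -
  have fin: "finite A" if "A \<subseteq> V" for A using that V by (rule finite_subset)
  have "bij_betw (insert i) (ksubsets (V - {i}) n) {A \<in> ksubsets V (Suc n). i \<in> A}"
    by (rule bij_betw_byWitness[where f' = "\<lambda>A. A - {i}"])
       (use i fin in \<open>auto simp: ksubsets_def card_insert_if subset_Diff_insert\<close>)
  then have "card {A \<in> ksubsets V (Suc n). i \<in> A} = card (ksubsets (V - {i}) n)"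
    by (simp add: bij_betw_same_card)
  then show ?thesis using V i by (simp add: card_ksubsets)
qed

text \<open>Three failures are added: bad columns \<open>J\<close>, a bad sample of short rows, and
  a long row in \<open>A\<close>. A row outside \<open>J\<close> lies in the fraction
  \<open>n' / M\<close> of the sets \<open>A\<close>, where \<open>M\<close> rows are outside, and
  on average at most \<open>M * \<eta>3\<close> of these are long; hence the factor
  \<open>n'\<close> and not \<open>card V\<close>.\<close>

lemma bad_block_count:
  fixes h :: "'i \<Rightarrow> 'i \<Rightarrow> real"
  assumes V: "finite V" and n: "n + n' < card V" and n'0: "0 < n'"
    and \<eta>1: "real (card {J \<in> ksubsets V n. \<not> block_bound h t1 V J}) \<le> real (card V choose n) * \<eta>1"
    and \<eta>2: "\<And>J. J \<in> ksubsets V n \<Longrightarrow> block_bound h t1 V J \<Longrightarrow>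
      real (card {A \<in> ksubsets (V - J) n'. (\<forall>i\<in>A. ip J (h i) (h i) \<le> B) \<and> \<not> block_bound h t2 A J})
        \<le> real (card (V - J) choose n') * \<eta>2"
    and \<eta>3: "\<And>i. i \<in> V \<Longrightarrow> real (card {J \<in> ksubsets (V - {i}) n. B < ip J (h i) (h i)}) \<le> real ((card V - 1) choose n) * \<eta>3"
    and nn: "0 \<le> \<eta>1" "0 \<le> \<eta>2"
  shows "(\<Sum>J\<in>ksubsets V n. real (card {A \<in> ksubsets (V - J) n'. \<not> block_bound h t2 A J}))
    \<le> real (card V choose n) * real ((card V - n) choose n') * (\<eta>1 + \<eta>2 + real n' * \<eta>3)"
proof -
  define M where "M = card V - n"
  define C where "C = real (M choose n')"
  have cM: "card (V - J) = M" "finite J" "J \<subseteq> V" if "J \<in> ksubsets V n" for J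
    using that ksubsets_finite[OF V that] unfolding M_def ksubsets_def by (auto simp: card_Diff_subset)
  have M: "n' < M" "0 < M" using n unfolding M_def by auto
  let ?bad = "\<lambda>J i. B < ip J (h i) (h i)"
  have one: "real (card {A \<in> ksubsets (V - J) n'. \<not> block_bound h t2 A J})
     \<le> C * of_bool (\<not> block_bound h t1 V J) + C * \<eta>2 + C * (real n' / real M) * real (card {i \<in> V - J. ?bad J i})"
    if J: "J \<in> ksubsets V n" for J
  proof (cases "block_bound h t1 V J")
    case False
    have "card {A \<in> ksubsets (V - J) n'. \<not> block_bound h t2 A J} \<le> card (ksubsets (V - J) n')"
      using V by (intro card_mono finite_ksubsets) auto
    then have "real (card {A \<in> ksubsets (V - J) n'. \<not> block_bound h t2 A J}) \<le> C"
      unfolding C_def using V by (simp add: card_ksubsets cM[OF J])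
    moreover have "0 \<le> C * \<eta>2 + C * (real n' / real M) * real (card {i \<in> V - J. ?bad J i})"
      unfolding C_def using nn by simp
    ultimately show ?thesis using False by simp
  next
    case True
    let ?A1 = "{A \<in> ksubsets (V - J) n'. (\<forall>i\<in>A. ip J (h i) (h i) \<le> B) \<and> \<not> block_bound h t2 A J}"
    let ?A2 = "\<Union>i\<in>{i \<in> V - J. ?bad J i}. {A \<in> ksubsets (V - J) n'. i \<in> A}"
    have fin: "finite (ksubsets (V - J) n')" using V by (intro finite_ksubsets) simp
    have "{A \<in> ksubsets (V - J) n'. \<not> block_bound h t2 A J} \<subseteq> ?A1 \<union> ?A2"
      by (auto simp: ksubsets_def not_le)
    then have "card {A \<in> ksubsets (V - J) n'. \<not> block_bound h t2 A J} \<le> card (?A1 \<union> ?A2)"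
      by (intro card_mono) (use fin V in auto)
    also have "\<dots> \<le> card ?A1 + card ?A2" by (rule card_Un_le)
    finally have A12: "card {A \<in> ksubsets (V - J) n'. \<not> block_bound h t2 A J} \<le> card ?A1 + card ?A2" .
    have "card ?A2 \<le> (\<Sum>i\<in>{i \<in> V - J. ?bad J i}. card {A \<in> ksubsets (V - J) n'. i \<in> A})"
      using V by (intro card_UN_le) simp
    also have "\<dots> = (\<Sum>i\<in>{i \<in> V - J. ?bad J i}. (M - 1) choose (n' - 1))"
    proof (rule sum.cong[OF refl])
      fix i assume "i \<in> {i \<in> V - J. ?bad J i}"
      then show "card {A \<in> ksubsets (V - J) n'. i \<in> A} = (M - 1) choose (n' - 1)"
        using card_ksubsets_containing[of "V - J" i "n' - 1"] V n'0 cM[OF J] by simp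
    qed
    also have "\<dots> = card {i \<in> V - J. ?bad J i} * ((M - 1) choose (n' - 1))" by simp
    finally have "real (card {A \<in> ksubsets (V - J) n'. \<not> block_bound h t2 A J})
      \<le> real (card ?A1 + card {i \<in> V - J. ?bad J i} * ((M - 1) choose (n' - 1)))"
      using A12 by (intro of_nat_mono) linarith
    then have "real (card {A \<in> ksubsets (V - J) n'. \<not> block_bound h t2 A J})
      \<le> real (card ?A1) + real (card {i \<in> V - J. ?bad J i}) * real ((M - 1) choose (n' - 1))"
      by simp
    moreover have "real (card ?A1) \<le> C * \<eta>2"
      using \<eta>2[OF J True] unfolding C_def cM[OF J] .
    moreover have "real ((M - 1) choose (n' - 1)) = C * (real n' / real M)"
    proof -
      have "n' * (M choose n') = M * ((M - 1) choose (n' - 1))"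
        using n'0 by (rule times_binomial_minus1_eq)
      then have "real n' * C = real M * real ((M - 1) choose (n' - 1))"
        unfolding C_def by (metis of_nat_mult)
      then show ?thesis using M by (simp add: field_simps)
    qed
    ultimately show ?thesis using True by (simp add: mult_ac)
  qed
  have three: "(\<Sum>J\<in>ksubsets V n. real (card {i \<in> V - J. ?bad J i})) \<le> real (card V choose n) * real M * \<eta>3"
  proof -
    have "(\<Sum>J\<in>ksubsets V n. card {i \<in> V - J. ?bad J i}) = (\<Sum>J\<in>ksubsets V n. card {i \<in> V. i \<notin> J \<and> ?bad J i})"
      by (intro sum.cong arg_cong[of _ _ card]) auto
    \<comment> \<open>After exchanging the sums, \<open>J\<close> ranges for fixed \<open>i\<close>
      over the subsets of \<open>V - {i}\<close>, the sampling to which the hypothesis on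
      \<open>\<eta>3\<close> refers.\<close>
    also have "\<dots> = (\<Sum>i\<in>V. card {J \<in> ksubsets V n. i \<notin> J \<and> ?bad J i})"
      by (rule sum_card_filter[OF finite_ksubsets[OF V] V])
    also have "\<dots> = (\<Sum>i\<in>V. card {J \<in> ksubsets (V - {i}) n. ?bad J i})"
    proof (intro sum.cong refl arg_cong[of _ _ card])
      fix i
      have "ksubsets (V - {i}) n = {J \<in> ksubsets V n. i \<notin> J}" unfolding ksubsets_def by blast
      then show "{J \<in> ksubsets V n. i \<notin> J \<and> ?bad J i} = {J \<in> ksubsets (V - {i}) n. ?bad J i}"
        by simp
    qed
    finally have "(\<Sum>J\<in>ksubsets V n. card {i \<in> V - J. ?bad J i}) = (\<Sum>i\<in>V. card {J \<in> ksubsets (V - {i}) n. ?bad J i})" .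
    then have "(\<Sum>J\<in>ksubsets V n. real (card {i \<in> V - J. ?bad J i})) = (\<Sum>i\<in>V. real (card {J \<in> ksubsets (V - {i}) n. ?bad J i}))"
      by (simp only: of_nat_sum[symmetric])
    also have "\<dots> \<le> (\<Sum>i\<in>V. real ((card V - 1) choose n) * \<eta>3)" by (intro sum_mono \<eta>3)
    also have "\<dots> = real (card V * ((card V - 1) choose n)) * \<eta>3" by simp
    also have "card V * ((card V - 1) choose n) = M * (card V choose n)"
      unfolding M_def using binomial_absorb_comp[of "card V" n] by simp
    finally show ?thesis by (simp add: mult_ac)
  qed
  have "(\<Sum>J\<in>ksubsets V n. real (card {A \<in> ksubsets (V - J) n'. \<not> block_bound h t2 A J}))
    \<le> (\<Sum>J\<in>ksubsets V n. C * of_bool (\<not> block_bound h t1 V J) + C * \<eta>2 + C * (real n' / real M) * real (card {i \<in> V - J. ?bad J i}))"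
    by (intro sum_mono one)
  also have "\<dots> = C * real (card {J \<in> ksubsets V n. \<not> block_bound h t1 V J}) + real (card V choose n) * (C * \<eta>2)
      + C * (real n' / real M) * (\<Sum>J\<in>ksubsets V n. real (card {i \<in> V - J. ?bad J i}))"
    using finite_ksubsets[OF V, of n]
    by (simp add: sum.distrib sum_distrib_left[symmetric] sum_divide_distrib[symmetric] card_ksubsets[OF V] sum_of_bool_eq Int_def)
  also have "\<dots> \<le> C * (real (card V choose n) * \<eta>1) + real (card V choose n) * (C * \<eta>2)
      + C * (real n' / real M) * (real (card V choose n) * real M * \<eta>3)"
    using \<eta>1 three by (intro add_mono mult_left_mono order_refl) (auto simp: C_def)
  also have "\<dots> = real (card V choose n) * C * (\<eta>1 + \<eta>2 + real n' * \<eta>3)"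
    using M by (simp add: field_simps)
  finally show ?thesis unfolding C_def M_def .
qed

section \<open>Decoupling\<close>

text \<open>All ordered pairs of distinct indices are separated by equally many \<open>J\<close>:
  besides \<open>j\<close>, the set takes \<open>n - 1\<close> of the \<open>card I - 2\<close>
  indices different from both. The diagonal is never separated.\<close>

lemma sum_split_pairs:
  fixes F :: "'a \<Rightarrow> 'a \<Rightarrow> real"
  assumes I: "finite I" and n: "0 < n"
  shows "(\<Sum>J\<in>ksubsets I n. \<Sum>i\<in>I - J. \<Sum>j\<in>J. F i j) = real ((card I - 2) choose (n - 1)) * (\<Sum>i\<in>I. \<Sum>j\<in>I - {i}. F i j)"
proof -
  have count: "(\<Sum>J\<in>ksubsets I n. of_bool (i \<notin> J \<and> j \<in> J)) = (of_bool (i \<noteq> j) * real ((card I - 2) choose (n - 1)) :: real)"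
    if ij: "i \<in> I" "j \<in> I" for i j
  proof (cases "i = j")
    case False
    have eq: "{J \<in> ksubsets I n. i \<notin> J \<and> j \<in> J} = {J \<in> ksubsets (I - {i}) n. j \<in> J}"
      unfolding ksubsets_def by blast
    have "card {J \<in> ksubsets I n. i \<notin> J \<and> j \<in> J} = (card (I - {i}) - 1) choose (n - 1)"
      unfolding eq using card_ksubsets_containing[of "I - {i}" j "n - 1"] I ij False n by simp
    moreover have "card (I - {i}) - 1 = card I - 2" using ij I by simp
    ultimately have "real (card {J \<in> ksubsets I n. i \<notin> J \<and> j \<in> J}) = real ((card I - 2) choose (n - 1))"
      by simp
    then show ?thesis using False finite_ksubsets[OF I, of n] by (simp add: sum_of_bool_eq Int_def)
  qed (auto intro!: sum.neutral)
  have "(\<Sum>J\<in>ksubsets I n. \<Sum>i\<in>I - J. \<Sum>j\<in>J. F i j)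
    = (\<Sum>J\<in>ksubsets I n. \<Sum>i\<in>I. \<Sum>j\<in>I. F i j * of_bool (i \<notin> J \<and> j \<in> J))"
  proof (rule sum.cong[OF refl])
    fix J assume "J \<in> ksubsets I n"
    then have J: "J \<subseteq> I" by (simp add: ksubsets_def)
    have "(\<Sum>i\<in>I - J. \<Sum>j\<in>J. F i j) = (\<Sum>i\<in>I - J. \<Sum>j\<in>I. F i j * of_bool (i \<notin> J \<and> j \<in> J))"
      using J I by (intro sum.cong refl sum.mono_neutral_cong_left) auto
    also have "\<dots> = (\<Sum>i\<in>I. \<Sum>j\<in>I. F i j * of_bool (i \<notin> J \<and> j \<in> J))"
      using I by (intro sum.mono_neutral_left) auto
    finally show "(\<Sum>i\<in>I - J. \<Sum>j\<in>J. F i j) = \<dots>" .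
  qed
  also have "\<dots> = (\<Sum>i\<in>I. \<Sum>j\<in>I. \<Sum>J\<in>ksubsets I n. F i j * of_bool (i \<notin> J \<and> j \<in> J))"
    by (subst sum.swap, rule sum.cong[OF refl], subst sum.swap, rule refl)
  also have "\<dots> = (\<Sum>i\<in>I. \<Sum>j\<in>I. F i j * (of_bool (i \<noteq> j) * real ((card I - 2) choose (n - 1))))"
    unfolding sum_distrib_left[symmetric] by (intro sum.cong refl) (simp only: count)
  also have "\<dots> = (\<Sum>i\<in>I. \<Sum>j\<in>I - {i}. F i j * real ((card I - 2) choose (n - 1)))"
    using I by (intro sum.cong refl sum.mono_neutral_cong_right) auto
  also have "\<dots> = real ((card I - 2) choose (n - 1)) * (\<Sum>i\<in>I. \<Sum>j\<in>I - {i}. F i j)"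
    unfolding sum_distrib_left by (simp add: mult.commute)
  finally show ?thesis .
qed

lemma block_form_le:
  assumes b: "block_bound h t A J" and t: "0 \<le> t"
  shows "\<bar>\<Sum>i\<in>A. y i * ip J (h i) x\<bar> \<le> sqrt t * (sqrt (ip A y y) * sqrt (ip J x x))"
proof -
  have "(\<Sum>i\<in>A. y i * ip J (h i) x)\<^sup>2 \<le> (\<Sum>i\<in>A. (y i)\<^sup>2) * (\<Sum>i\<in>A. (ip J (h i) x)\<^sup>2)"
    by (rule Cauchy_Schwarz_ineq_sum)
  also have "\<dots> \<le> ip A y y * (t * ip J x x)"
    using b unfolding block_bound_def by (intro mult_mono) (auto simp: ip_def power2_eq_square sum_nonneg)
  finally have "(\<Sum>i\<in>A. y i * ip J (h i) x)\<^sup>2 \<le> t * (ip A y y * ip J x x)" by (simp add: mult_ac)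
  then have "sqrt ((\<Sum>i\<in>A. y i * ip J (h i) x)\<^sup>2) \<le> sqrt (t * (ip A y y * ip J x x))"
    by (rule real_sqrt_le_mono)
  then show ?thesis by (simp add: real_sqrt_mult)
qed

lemma block_bound_entries:
  assumes "finite A" "finite J" and \<mu>: "\<And>i j. i \<in> A \<Longrightarrow> j \<in> J \<Longrightarrow> \<bar>h i j\<bar> \<le> \<mu>"
  shows "block_bound h (real (card A) * real (card J) * \<mu>\<^sup>2) A J"
  unfolding block_bound_def
proof
  fix y
  have "(ip J (h i) y)\<^sup>2 \<le> (real (card J) * \<mu>\<^sup>2) * ip J y y" if i: "i \<in> A" for i
  proof -
    have "ip J (h i) (h i) \<le> real (card J) * \<mu>\<^sup>2"
      unfolding ip_def using abs_le_square_iff[of "h i _" \<mu>] \<mu>[OF i]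
      by (intro sum_bounded_above) (metis abs_ge_zero abs_le_iff abs_of_nonneg order_trans power2_eq_square)
    then have "ip J (h i) (h i) * ip J y y \<le> (real (card J) * \<mu>\<^sup>2) * ip J y y"
      using ip_nonneg by (intro mult_right_mono)
    then show ?thesis using ip_Cauchy_Schwarz[of J "h i" y] by linarith
  qed
  then have "(\<Sum>i\<in>A. (ip J (h i) y)\<^sup>2) \<le> real (card A) * ((real (card J) * \<mu>\<^sup>2) * ip J y y)"
    by (intro sum_bounded_above)
  then show "(\<Sum>i\<in>A. (ip J (h i) y)\<^sup>2) \<le> real (card A) * real (card J) * \<mu>\<^sup>2 * ip J y y"
    by (simp add: mult_ac)
qed

text \<open>Choosing \<open>y\<close> as the image of \<open>x\<close> turns the bilinear bound into
  a norm bound after one factor \<open>sqrt X\<close> is cancelled.\<close>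

lemma block_bound_of_form:
  assumes d: "0 \<le> d" and f: "\<And>y. \<bar>\<Sum>i\<in>I. y i * ip I (h i) x\<bar> \<le> d * (sqrt (ip I y y) * sqrt (ip I x x))"
  shows "(\<Sum>i\<in>I. (ip I (h i) x)\<^sup>2) \<le> d\<^sup>2 * ip I x x"
proof -
  define y where "y i = ip I (h i) x" for i
  define X where "X = (\<Sum>i\<in>I. (ip I (h i) x)\<^sup>2)"
  have X: "X = ip I y y" "X = (\<Sum>i\<in>I. y i * ip I (h i) x)"
    unfolding X_def y_def ip_def by (simp_all add: power2_eq_square)
  have X0: "0 \<le> X" unfolding X(1) by (rule ip_nonneg)
  have "X \<le> d * (sqrt X * sqrt (ip I x x))" using f[of y] unfolding X(1)[symmetric] X(2)[symmetric] by simp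
  then have "sqrt X * sqrt X \<le> (d * sqrt (ip I x x)) * sqrt X" using X0 by (simp add: mult_ac)
  then have "sqrt X \<le> d * sqrt (ip I x x)"
    using X0 d ip_nonneg[of I x] by (cases "X = 0") (simp, erule mult_right_le_imp_le, simp)
  then have "(sqrt X)\<^sup>2 \<le> (d * sqrt (ip I x x))\<^sup>2" using X0 by (intro power_mono) auto
  then show ?thesis using X0 ip_nonneg[of I x] unfolding X_def[symmetric] by (simp add: power_mult_distrib)
qed

text \<open>The share of halves separating a given ordered pair is
  \<open>n * n' / (k * (k - 1))\<close>, at least \<open>1 / 4\<close> since
  \<open>4 * n * n'\<close> is \<open>k^2\<close> or \<open>k^2 - 1\<close>.\<close>

lemma binomial_half_le:
  assumes "2 \<le> k"
  shows "(k choose (k - k div 2)) \<le> 4 * ((k - 2) choose (k - k div 2 - 1))"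
proof -
  define n where "n = k - k div 2"
  define n' where "n' = k div 2"
  have n: "0 < n" "0 < n'" "k = n + n'" using assms unfolding n_def n'_def by auto
  have 1: "n * (k choose n) = k * ((k - 1) choose (n - 1))"
    using n(1) by (rule times_binomial_minus1_eq)
  have 2: "((k - 1) - (n - 1)) * ((k - 1) choose (n - 1)) = (k - 1) * ((k - 1 - 1) choose (n - 1))"
    by (rule binomial_absorb_comp)
  have 3: "(k - 1) - (n - 1) = n'" "k - 1 - 1 = k - 2" using n by auto
  have "n' * n * (k choose n) = k * (n' * ((k - 1) choose (n - 1)))" using 1 by (simp add: mult_ac)
  also have "\<dots> = k * (k - 1) * ((k - 2) choose (n - 1))" using 2 unfolding 3 by (simp add: mult_ac)
  also have "k * (k - 1) \<le> 4 * (n' * n)"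
  proof (cases "even k")
    case True
    then obtain l where "k = 2 * l" by (elim evenE)
    then show ?thesis unfolding n_def n'_def by (simp add: algebra_simps)
  next
    case False
    then obtain l where "k = 2 * l + 1" by (elim oddE)
    then show ?thesis unfolding n_def n'_def by (simp add: algebra_simps)
  qed
  finally have "(n' * n) * (k choose n) \<le> (n' * n) * (4 * ((k - 2) choose (n - 1)))" by (simp add: mult_ac)
  then show ?thesis using n unfolding n_def[symmetric] by simp
qed

text \<open>Average of the split form over all halves. A separating share of at least
  \<open>1 / 4\<close>, with both orders of a pair used at once, gives the factor 2. A half with a
  bad block is charged the entrywise bound \<open>k * \<mu> / 2\<close> instead.\<close>

lemma decoupled_form_le:
  fixes h :: "'i \<Rightarrow> 'i \<Rightarrow> real"
  assumes I: "finite I" "card I = k" "2 \<le> k"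
    and sym: "\<And>i j. h i j = h j i" and diag: "\<And>i. h i i = 0"
    and \<mu>: "\<And>i j. i \<in> I \<Longrightarrow> j \<in> I \<Longrightarrow> \<bar>h i j\<bar> \<le> \<mu>" "0 \<le> \<mu>" and t: "0 \<le> t"
  defines "n \<equiv> k - k div 2"
  defines "f \<equiv> real (card {J \<in> ksubsets I n. \<not> block_bound h t (I - J) J})"
  shows "\<bar>\<Sum>i\<in>I. y i * ip I (h i) x\<bar>
    \<le> (2 * sqrt t + f / real (k choose n) * (real k * \<mu>)) * (sqrt (ip I y y) * sqrt (ip I x x))"
proof -
  have n0: "0 < n" "n \<le> k" unfolding n_def using I(3) by auto
  define C where "C = real ((k - 2) choose (n - 1))"
  have C0: "0 < C" unfolding C_def using n0 I(3) unfolding n_def by (simp add: zero_less_binomial_iff)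
  have C4: "real (k choose n) \<le> 4 * C"
    unfolding C_def n_def using binomial_half_le[OF I(3)] by (metis of_nat_le_iff of_nat_mult of_nat_numeral)
  have Ck: "0 < real (k choose n)" using n0 by (simp add: zero_less_binomial_iff)
  define Q where "Q = (\<Sum>i\<in>I. y i * ip I (h i) x)"
  define z where "z = sqrt (ip I y y) * sqrt (ip I x x)"
  have z0: "0 \<le> z" unfolding z_def by (simp add: ip_nonneg)
  \<comment> \<open>The block and its transpose are kept together: over all \<open>J\<close> they
    add up to a multiple of \<open>2 * Q\<close>, yet each \<open>b J\<close> costs only one block
    norm.\<close>
  define b where "b J = (\<Sum>i\<in>I - J. \<Sum>j\<in>J. y i * h i j * x j + x i * h i j * y j)" for J
  have bl: "\<bar>b J\<bar> \<le> sqrt s * z" if J: "J \<in> ksubsets I n" and s: "block_bound h s (I - J) J" "0 \<le> s" for J s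
  proof -
    have JI: "J \<subseteq> I" using J by (simp add: ksubsets_def)
    have split: "ip I w w = ip (I - J) w w + ip J w w" for w
      unfolding ip_def using sum.subset_diff[OF JI I(1)] by (simp add: add.commute)
    have "b J = (\<Sum>i\<in>I - J. y i * ip J (h i) x) + (\<Sum>i\<in>I - J. x i * ip J (h i) y)"
      unfolding b_def ip_def by (simp add: sum.distrib sum_distrib_left mult.assoc)
    then have "\<bar>b J\<bar> \<le> sqrt s * (sqrt (ip (I - J) y y) * sqrt (ip J x x)) + sqrt s * (sqrt (ip (I - J) x x) * sqrt (ip J y y))"
      using block_form_le[OF s, of y x] block_form_le[OF s, of x y] by linarith
    also have "\<dots> = sqrt s * (sqrt (ip (I - J) y y) * sqrt (ip J x x) + sqrt (ip J y y) * sqrt (ip (I - J) x x))"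
      by (simp add: algebra_simps)
    also have "\<dots> \<le> sqrt s * z"
    proof (intro mult_left_mono)
      \<comment> \<open>Cauchy-Schwarz in the plane for the lengths of the two halves of
        \<open>x\<close> and \<open>y\<close>; estimating the two terms separately would double the
        bound.\<close>
      have cs: "a * d + b * c \<le> sqrt (a\<^sup>2 + b\<^sup>2) * sqrt (c\<^sup>2 + d\<^sup>2)" for a b c d :: real
      proof -
        have "(a * d + b * c)\<^sup>2 \<le> (a\<^sup>2 + b\<^sup>2) * (c\<^sup>2 + d\<^sup>2)"
          using zero_le_power2[of "a * c - b * d"] by (simp add: power2_eq_square algebra_simps)
        then have "a * d + b * c \<le> sqrt ((a\<^sup>2 + b\<^sup>2) * (c\<^sup>2 + d\<^sup>2))" by (rule real_le_rsqrt)
        then show ?thesis by (simp add: real_sqrt_mult)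
      qed
      show "sqrt (ip (I - J) y y) * sqrt (ip J x x) + sqrt (ip J y y) * sqrt (ip (I - J) x x) \<le> z"
        using cs[of "sqrt (ip (I - J) y y)" "sqrt (ip J x x)" "sqrt (ip J y y)" "sqrt (ip (I - J) x x)"]
        unfolding z_def split[of x] split[of y] by (simp add: ip_nonneg)
    qed (use s in simp)
    finally show ?thesis .
  qed
  have triv: "\<bar>b J\<bar> \<le> (real k * \<mu> / 2) * z" if J: "J \<in> ksubsets I n" for J
  proof -
    have JI: "J \<subseteq> I" "card J = n" "finite J" using J ksubsets_finite[OF I(1) J] by (auto simp: ksubsets_def)
    have cA: "card (I - J) = k - n" using JI I by (simp add: card_Diff_subset)
    have "block_bound h (real (card (I - J)) * real (card J) * \<mu>\<^sup>2) (I - J) J"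
      using I(1) JI \<mu>(1) by (intro block_bound_entries) auto
    then have "\<bar>b J\<bar> \<le> sqrt (real (card (I - J)) * real (card J) * \<mu>\<^sup>2) * z" using J by (intro bl) auto
    also have "sqrt (real (card (I - J)) * real (card J) * \<mu>\<^sup>2) \<le> real k * \<mu> / 2"
    proof (rule real_le_lsqrt)
      have "4 * (real (k - n) * real n) \<le> (real k)\<^sup>2"
        using zero_le_power2[of "real k - 2 * real n"] n0 by (simp add: of_nat_diff power2_eq_square algebra_simps)
      then have "4 * (real (k - n) * real n) * \<mu>\<^sup>2 \<le> (real k)\<^sup>2 * \<mu>\<^sup>2" by (intro mult_right_mono) auto
      then show "real (card (I - J)) * real (card J) * \<mu>\<^sup>2 \<le> (real k * \<mu> / 2)\<^sup>2"
        unfolding cA JI by (simp add: power_mult_distrib power_divide)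
    qed (use \<mu>(2) in auto)
    finally show ?thesis using z0 by (simp add: mult_right_mono)
  qed
  have nodiag: "(\<Sum>j\<in>I - {i}. F i j) = (\<Sum>j\<in>I. F i j)" if "F i i = 0" for F :: "'i \<Rightarrow> 'i \<Rightarrow> real" and i
    using that I(1) by (intro sum.mono_neutral_left) auto
  have "(\<Sum>J\<in>ksubsets I n. b J) = C * (\<Sum>i\<in>I. \<Sum>j\<in>I - {i}. y i * h i j * x j + x i * h i j * y j)"
    unfolding b_def C_def using sum_split_pairs[OF I(1) n0(1)] I(2) by simp
  also have "(\<Sum>i\<in>I. \<Sum>j\<in>I - {i}. y i * h i j * x j + x i * h i j * y j) = (\<Sum>i\<in>I. \<Sum>j\<in>I. y i * h i j * x j + x i * h i j * y j)"
    by (intro sum.cong refl nodiag) (simp add: diag)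
  also have "\<dots> = (\<Sum>i\<in>I. \<Sum>j\<in>I. y i * h i j * x j) + (\<Sum>j\<in>I. \<Sum>i\<in>I. x i * h i j * y j)"
    unfolding sum.distrib by (rule arg_cong2[of _ _ _ _ "(+)", OF refl sum.swap])
  also have "(\<Sum>j\<in>I. \<Sum>i\<in>I. x i * h i j * y j) = (\<Sum>i\<in>I. \<Sum>j\<in>I. y i * h i j * x j)"
    by (intro sum.cong refl) (simp add: sym mult_ac)
  also have "(\<Sum>i\<in>I. \<Sum>j\<in>I. y i * h i j * x j) = Q"
    unfolding Q_def ip_def by (simp add: sum_distrib_left mult.assoc)
  finally have main: "(\<Sum>J\<in>ksubsets I n. b J) = C * (2 * Q)" by simp
  have "\<bar>C * (2 * Q)\<bar> \<le> (\<Sum>J\<in>ksubsets I n. \<bar>b J\<bar>)" unfolding main[symmetric] by (rule sum_abs)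
  also have "\<dots> \<le> (\<Sum>J\<in>ksubsets I n. sqrt t * z + of_bool (\<not> block_bound h t (I - J) J) * ((real k * \<mu> / 2) * z))"
  proof (rule sum_mono)
    fix J assume J: "J \<in> ksubsets I n"
    have "0 \<le> sqrt t * z" using t z0 by simp
    then show "\<bar>b J\<bar> \<le> sqrt t * z + of_bool (\<not> block_bound h t (I - J) J) * ((real k * \<mu> / 2) * z)"
      using triv[OF J] bl[OF J _ t] by (cases "block_bound h t (I - J) J") auto
  qed
  also have "\<dots> = real (k choose n) * (sqrt t * z) + f * ((real k * \<mu> / 2) * z)"
    unfolding sum.distrib sum_distrib_right[symmetric] f_def
    using finite_ksubsets[OF I(1), of n] by (simp add: card_ksubsets[OF I(1)] I(2) sum_of_bool_eq Int_def)
  also have "\<dots> = real (k choose n) / 2 * ((2 * sqrt t + f / real (k choose n) * (real k * \<mu>)) * z)"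
    using Ck by (simp add: field_simps)
  also have "\<dots> \<le> (4 * C) / 2 * ((2 * sqrt t + f / real (k choose n) * (real k * \<mu>)) * z)"
    using C4 t z0 \<mu>(2) by (intro mult_right_mono divide_right_mono) (auto simp: f_def)
  finally have le: "(2 * C) * \<bar>Q\<bar> \<le> (2 * C) * ((2 * sqrt t + f / real (k choose n) * (real k * \<mu>)) * z)"
    using C0 by (simp add: abs_mult)
  have "0 < 2 * C" using C0 by simp
  then show ?thesis unfolding Q_def[symmetric] z_def[symmetric] by (rule mult_left_le_imp_le[OF le])
qed

text \<open>A pair of disjoint sets can be drawn as \<open>I\<close> and then its part
  \<open>J\<close>, or as \<open>J\<close> and then \<open>A = I - J\<close> from the
  complement.\<close>

lemma sum_ksubsets_split:
  assumes V: "finite V"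
  shows "(\<Sum>I\<in>ksubsets V (n + n'). card {J \<in> ksubsets I n. P (I - J) J}) = (\<Sum>J\<in>ksubsets V n. card {A \<in> ksubsets (V - J) n'. P A J})"
proof -
  have fin: "finite J" if "J \<subseteq> V" for J using that V by (rule finite_subset)
  have fin': "finite I" if "I \<in> ksubsets V m" for I m by (rule ksubsets_finite[OF V that])
  have "(\<Sum>I\<in>ksubsets V (n + n'). card {J \<in> ksubsets I n. P (I - J) J})
    = card (SIGMA I:ksubsets V (n + n'). {J \<in> ksubsets I n. P (I - J) J})"
    using V fin' by (intro card_SigmaI[symmetric]) (simp_all add: finite_ksubsets)
  also have "\<dots> = card (SIGMA J:ksubsets V n. {A \<in> ksubsets (V - J) n'. P A J})"
  proof (rule bij_betw_same_card[OF bij_betw_byWitness[where f = "\<lambda>(I, J). (J, I - J)" and f' = "\<lambda>(J, A). (J \<union> A, J)"]])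
    show "\<forall>a\<in>(SIGMA I:ksubsets V (n + n'). {J \<in> ksubsets I n. P (I - J) J}).
        (case case a of (I, J) \<Rightarrow> (J, I - J) of (J, A) \<Rightarrow> (J \<union> A, J)) = a"
      unfolding ksubsets_def by auto
    show "\<forall>a\<in>(SIGMA J:ksubsets V n. {A \<in> ksubsets (V - J) n'. P A J}).
        (case case a of (J, A) \<Rightarrow> (J \<union> A, J) of (I, J) \<Rightarrow> (J, I - J)) = a"
      unfolding ksubsets_def by auto
    show "(\<lambda>(I, J). (J, I - J)) ` (SIGMA I:ksubsets V (n + n'). {J \<in> ksubsets I n. P (I - J) J})
      \<subseteq> (SIGMA J:ksubsets V n. {A \<in> ksubsets (V - J) n'. P A J})"
    proof clarsimp
      fix I J assume *: "I \<in> ksubsets V (n + n')" "J \<in> ksubsets I n" "P (I - J) J"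
      then have "I \<subseteq> V" "card I = n + n'" "J \<subseteq> I" "card J = n" by (simp_all add: ksubsets_def)
      then show "J \<in> ksubsets V n \<and> I - J \<in> ksubsets (V - J) n'"
        unfolding ksubsets_def using fin[of J] by (simp add: card_Diff_subset) blast
    qed
    show "(\<lambda>(J, A). (J \<union> A, J)) ` (SIGMA J:ksubsets V n. {A \<in> ksubsets (V - J) n'. P A J})
      \<subseteq> (SIGMA I:ksubsets V (n + n'). {J \<in> ksubsets I n. P (I - J) J})"
    proof clarsimp
      fix J A assume *: "J \<in> ksubsets V n" "A \<in> ksubsets (V - J) n'" "P A J"
      then have s: "J \<subseteq> V" "card J = n" "A \<subseteq> V - J" "card A = n'" by (simp_all add: ksubsets_def)
      have "(J \<union> A) - J = A" using s by blast
      moreover have "card (J \<union> A) = n + n'"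
        using s fin[of J] fin[of A] by (subst card_Un_disjoint) auto
      ultimately show "J \<union> A \<in> ksubsets V (n + n') \<and> J \<in> ksubsets (J \<union> A) n \<and> P (J \<union> A - J) J"
        using s *(3) unfolding ksubsets_def by auto
    qed
  qed
  also have "\<dots> = (\<Sum>J\<in>ksubsets V n. card {A \<in> ksubsets (V - J) n'. P A J})"
    using V by (intro card_SigmaI) (simp_all add: finite_ksubsets)
  finally show ?thesis .
qed

text \<open>Markov's inequality for the share of bad halves: if the norm on \<open>I\<close> exceeds
  \<delta>, this share times \<open>k * \<mu>\<close> is at least the gap
  \<open>\<delta> - 2 * sqrt t\<close>, while its average over \<open>I\<close> is at most
  \<eta>.\<close>

lemma decoupled_count:
  fixes h :: "'i \<Rightarrow> 'i \<Rightarrow> real"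
  assumes V: "finite V" and k: "2 \<le> k" "k \<le> card V"
    and sym: "\<And>i j. h i j = h j i" and diag: "\<And>i. h i i = 0"
    and \<mu>: "\<And>i j. i \<in> V \<Longrightarrow> j \<in> V \<Longrightarrow> \<bar>h i j\<bar> \<le> \<mu>" "0 \<le> \<mu>" and t: "0 \<le> t" "2 * sqrt t < \<delta>"
  defines "n \<equiv> k - k div 2"
  assumes bad: "(\<Sum>J\<in>ksubsets V n. real (card {A \<in> ksubsets (V - J) (k div 2). \<not> block_bound h t A J}))
    \<le> real (card V choose n) * real ((card V - n) choose (k div 2)) * \<eta>"
  shows "real (card {I \<in> ksubsets V k. \<not> block_bound h (\<delta>\<^sup>2) I I}) * (\<delta> - 2 * sqrt t) \<le> real (card V choose k) * (real k * \<mu> * \<eta>)"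
proof -
  define f where "f I = real (card {J \<in> ksubsets I n. \<not> block_bound h t (I - J) J})" for I
  have n: "n + k div 2 = k" "n \<le> k" unfolding n_def by auto
  have Ck: "0 < real (k choose n)" using n by (simp add: zero_less_binomial_iff)
  let ?B = "{I \<in> ksubsets V k. \<not> block_bound h (\<delta>\<^sup>2) I I}"
  have each: "(\<delta> - 2 * sqrt t) * real (k choose n) \<le> f I * (real k * \<mu>)" if I: "I \<in> ?B" for I
  proof (rule ccontr)
    assume "\<not> ?thesis"
    then have "f I * (real k * \<mu>) \<le> (\<delta> - 2 * sqrt t) * real (k choose n)" by simp
    then have le: "2 * sqrt t + f I / real (k choose n) * (real k * \<mu>) \<le> \<delta>" using Ck by (simp add: field_simps)
    have Ik: "I \<subseteq> V" "card I = k" "finite I" using I ksubsets_finite[OF V, of I k] by (auto simp: ksubsets_def)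
    have "block_bound h (\<delta>\<^sup>2) I I"
      unfolding block_bound_def
    proof (intro allI block_bound_of_form)
      show "0 \<le> \<delta>" using t by (meson dual_order.trans less_imp_le mult_nonneg_nonneg real_sqrt_ge_zero zero_le_numeral)
      fix x y
      have "\<bar>\<Sum>i\<in>I. y i * ip I (h i) x\<bar> \<le> (2 * sqrt t + f I / real (k choose n) * (real k * \<mu>)) * (sqrt (ip I y y) * sqrt (ip I x x))"
        unfolding f_def n_def using Ik \<mu> by (intro decoupled_form_le k(1) sym diag t(1)) auto
      also have "\<dots> \<le> \<delta> * (sqrt (ip I y y) * sqrt (ip I x x))"
        using le by (intro mult_right_mono) (auto simp: ip_nonneg)
      finally show "\<bar>\<Sum>i\<in>I. y i * ip I (h i) x\<bar> \<le> \<delta> * (sqrt (ip I y y) * sqrt (ip I x x))" .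
    qed
    then show False using I by simp
  qed
  have "real (card ?B) * ((\<delta> - 2 * sqrt t) * real (k choose n)) \<le> (\<Sum>I\<in>?B. f I * (real k * \<mu>))"
    by (intro sum_bounded_below each)
  also have "\<dots> \<le> (\<Sum>I\<in>ksubsets V k. f I * (real k * \<mu>))"
    using \<mu>(2) by (intro sum_mono2 finite_ksubsets V) (auto simp: f_def)
  also have "\<dots> = real (\<Sum>I\<in>ksubsets V k. card {J \<in> ksubsets I n. \<not> block_bound h t (I - J) J}) * (real k * \<mu>)"
    by (simp add: f_def sum_distrib_right)
  also have "(\<Sum>I\<in>ksubsets V k. card {J \<in> ksubsets I n. \<not> block_bound h t (I - J) J})
     = (\<Sum>J\<in>ksubsets V n. card {A \<in> ksubsets (V - J) (k div 2). \<not> block_bound h t A J})"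
    using sum_ksubsets_split[OF V, where n = n and n' = "k div 2" and P = "\<lambda>A J. \<not> block_bound h t A J"] unfolding n(1) .
  also have "real \<dots> * (real k * \<mu>) \<le> (real (card V choose n) * real ((card V - n) choose (k div 2)) * \<eta>) * (real k * \<mu>)"
    using bad \<mu>(2) by (intro mult_right_mono) auto
  also have "real (card V choose n) * real ((card V - n) choose (k div 2)) = real (card V choose k) * real (k choose n)"
    unfolding of_nat_mult[symmetric] using choose_mult[OF n(2) k(2)] n by (metis add_diff_cancel_left')
  finally have "(real (card ?B) * (\<delta> - 2 * sqrt t)) * real (k choose n) \<le> (real (card V choose k) * (real k * \<mu> * \<eta>)) * real (k choose n)"
    by (simp add: mult_ac)
  then show ?thesis using Ck by (simp only: mult_le_cancel_right_pos)
qed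

section \<open>Tail estimates\<close>

text \<open>With \<open>\<tau> = x / R\<close> the Chernoff exponent is at most
  \<open>k * x\<^sup>2 - (1 - a) * x * t / R\<close>. The chosen \<open>x\<close> minimises this,
  with minimum \<open>- (1 - a)\<^sup>2 * t\<^sup>2 / (4 * k * R\<^sup>2)\<close>, which is at most
  \<open>- Z\<close> by hypothesis.\<close>

lemma row_norm_tail:
  fixes h :: "'i \<Rightarrow> 'i \<Rightarrow> real" and k :: real
  assumes V: "finite V" and i: "i \<in> V"
    and \<rho>: "ip V (h i) (h i) \<le> \<rho>" "0 \<le> \<rho>"
    and \<mu>: "\<And>j. j \<in> V \<Longrightarrow> \<bar>h i j\<bar> \<le> \<mu>"
    and K: "0 < K" "K + real n \<le> real (card V)" and nk: "real n \<le> k" and t: "0 < t"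
    and a: "0 < a" "a < 1" and m: "real n * (\<rho> / K) \<le> a * t"
    and Z: "Z * (4 * k * \<mu> ^ 4) \<le> (1 - a)\<^sup>2 * t\<^sup>2" "1 \<le> Z"
  shows "real (card {J \<in> ksubsets (V - {i}) n. t < ip J (h i) (h i)})
    \<le> real ((card V - 1) choose n) * (2 * real n * exp (- Z))" (is "real (card ?B) \<le> ?C * _")
proof (cases "k * \<mu>\<^sup>2 \<le> t")
  \<comment> \<open>Even \<open>n\<close> entries of maximal size do not reach a squared norm above
    \<open>t\<close>. The other case provides \<open>t < k * R\<close>, which keeps \<open>x\<close>
    at most \<open>1 / 2\<close>.\<close>
  case True
  have "ip J (h i) (h i) \<le> t" if J: "J \<in> ksubsets (V - {i}) n" for J
  proof -
    have "ip J (h i) (h i) \<le> real (card J) * \<mu>\<^sup>2"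
      unfolding ip_def
    proof (rule sum_bounded_above)
      fix j assume "j \<in> J"
      then have "\<bar>h i j\<bar> \<le> \<mu>" using \<mu> J by (auto simp: ksubsets_def)
      then show "h i j * h i j \<le> \<mu>\<^sup>2" by (metis abs_le_square_iff abs_ge_self order_trans power2_eq_square)
    qed
    also have "\<dots> \<le> k * \<mu>\<^sup>2" using J nk by (intro mult_right_mono) (auto simp: ksubsets_def)
    finally show ?thesis using True by simp
  qed
  then have "?B = {}" by (auto simp: not_less)
  then have "card ?B = 0" by (simp only: card.empty)
  then show ?thesis by simp
next
  case False
  define R where "R = \<mu>\<^sup>2"
  have kR: "t < k * R" using False unfolding R_def by simp
  then have R: "0 < R" using t unfolding R_def by (cases "\<mu> = 0") auto
  have k0: "0 < k" using kR t R by (metis less_trans zero_less_mult_pos2)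
  define x where "x = (1 - a) * t / (2 * k * R)"
  have x0: "0 < x" unfolding x_def using a t k0 R by simp
  have "(1 - a) * t \<le> 1 * (k * R)" using a t kR by (intro mult_mono) auto
  then have x1: "x \<le> 1 / 2" unfolding x_def using k0 R by (simp add: field_simps)
  define g where "g = exp x - 1"
  have g0: "0 \<le> g" unfolding g_def using x0 by simp
  have g1: "g \<le> x + x\<^sup>2" unfolding g_def using exp_bound[of x] x0 x1 by simp
  have "x\<^sup>2 \<le> (1 / 2)\<^sup>2" using x0 x1 by (intro power_mono) auto
  then have g2: "g \<le> 1" using g1 x1 by (simp add: power2_eq_square)
  have x2: "(1 - a) * t / R = 2 * k * x" unfolding x_def using k0 R by (simp add: field_simps)
  have Zx: "Z \<le> k * x\<^sup>2"
  proof -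
    have "k * (w / (2 * k * R))\<^sup>2 = w\<^sup>2 / (4 * k * R\<^sup>2)" for w
      using k0 R by (simp add: power2_eq_square)
    moreover have "R\<^sup>2 = \<mu> ^ 4" unfolding R_def by (simp flip: power_mult)
    ultimately have "k * x\<^sup>2 = (1 - a)\<^sup>2 * t\<^sup>2 / (4 * k * \<mu> ^ 4)"
      unfolding x_def by (simp add: power_mult_distrib)
    moreover have "0 < 4 * k * \<mu> ^ 4" using k0 R unfolding R_def by simp
    ultimately show ?thesis using Z(1) by (simp add: le_divide_eq)
  qed
  define y where "y = x * t / R"
  have "(1 - a) * y = 2 * (k * x\<^sup>2)" 
  proof -
    have "(1 - a) * y = x * ((1 - a) * t / R)" unfolding y_def by simp
    then show ?thesis unfolding x2 by (simp add: power2_eq_square)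
  qed
  moreover have "(1 - a) * y \<le> 1 * y" unfolding y_def using a x0 t R by (intro mult_right_mono) auto
  ultimately have y: "1 \<le> y" "a * y = y - 2 * (k * x\<^sup>2)" using Zx Z(2) by (auto simp: algebra_simps)
  have E: "real n * g * (\<rho> / K) / R \<le> y - k * x\<^sup>2"
  proof -
    have "real n * g * (\<rho> / K) / R = g / R * (real n * (\<rho> / K))" by (simp add: mult_ac)
    also have "\<dots> \<le> (x + x\<^sup>2) / R * (a * t)"
      using R x0 \<rho>(2) K(1) by (intro mult_mono[OF divide_right_mono[OF g1] m]) auto
    also have "\<dots> = a * y + x\<^sup>2 * (a * (t / R))" unfolding y_def by (simp add: algebra_simps add_divide_distrib)
    also have "\<dots> \<le> a * y + x\<^sup>2 * k"
    proof (intro add_left_mono mult_left_mono)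
      \<comment> \<open>The second-order error of the exponential,
        \<open>x\<^sup>2 * a * t / R\<close>, becomes at most \<open>k * x\<^sup>2\<close>; here
        \<open>t < k * R\<close> enters.\<close>
      have "a * (t / R) \<le> 1 * k" using a t R kR k0 by (intro mult_mono) (auto simp: field_simps)
      then show "a * (t / R) \<le> k" by simp
    qed simp
    finally show ?thesis using y(2) by (simp add: mult.commute)
  qed
  have "real (card ?B) * (exp (x / R * t) - 1)
    \<le> ?C * (real n * (exp (x / R * R) - 1) * exp (real n * (exp (x / R * R) - 1) * (\<rho> / K) / R))"
  proof (intro row_norm_Chernoff V i \<rho> R K)
    show "(h i j)\<^sup>2 \<le> R" if "j \<in> V" for j
      unfolding R_def using \<mu>[OF that] by (metis abs_le_square_iff abs_ge_self order_trans)
  qed (use t x0 R in auto)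
  then have "real (card ?B) * (exp y - 1) \<le> ?C * (real n * g * exp (real n * g * (\<rho> / K) / R))"
    using R unfolding g_def y_def by simp
  also have "\<dots> \<le> ?C * (real n * 1 * exp (y - Z))"
    using E Zx g0 g2 by (intro mult_left_mono mult_mono) auto
  also have "\<dots> = ?C * real n * exp (- Z) * exp y" by (simp add: exp_diff exp_minus field_simps)
  finally have 1: "real (card ?B) * (exp y - 1) \<le> ?C * real n * exp (- Z) * exp y" .
  have "2 \<le> exp y" using exp_ge_add_one_self[of y] y by linarith
  then have "exp y \<le> 2 * (exp y - 1)" by simp
  then have "real (card ?B) * exp y \<le> real (card ?B) * (2 * (exp y - 1))" by (intro mult_left_mono) auto
  also have "\<dots> = 2 * (real (card ?B) * (exp y - 1))" by (simp only: mult_ac)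
  also have "\<dots> \<le> 2 * (?C * real n * exp (- Z) * exp y)" using 1 by (intro mult_left_mono) auto
  also have "\<dots> = (?C * (2 * real n * exp (- Z))) * exp y" by (simp only: mult_ac)
  finally show ?thesis by (simp only: mult_le_cancel_right_pos exp_gt_zero)
qed

text \<open>The free parameters of the sampling steps are fixed here: deviation \<open>9 * L\<close>
  in both matrix steps, thresholds \<open>t1\<close> after the columns and \<open>t2\<close> after
  the rows, and \<open>K = N - k\<close>, which bounds the number of candidates at every
  draw.\<close>

theorem random_principal_block:
  fixes h :: "'i \<Rightarrow> 'i \<Rightarrow> real" and a b c \<delta> \<epsilon> \<mu> \<Lambda> :: real
  assumes V: "finite V" and k: "2 \<le> k" "k \<le> card V"
    and sym: "\<And>i j. h i j = h j i" and diag: "\<And>i. h i i = 0"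
    and \<mu>: "\<And>i j. i \<in> V \<Longrightarrow> j \<in> V \<Longrightarrow> \<bar>h i j\<bar> \<le> \<mu>" "0 \<le> \<mu>"
    and \<Lambda>: "block_bound h (\<Lambda>\<^sup>2) V V" "1 \<le> \<Lambda>"
    and \<delta>: "0 < \<delta>" "\<delta> < 1" and \<epsilon>: "0 < \<epsilon>" "\<epsilon> < 1 / real k"
    and abc: "0 < a" "a < 1" "0 < b" "0 < c"
    and k\<mu>: "real k * \<mu> ^ 4 \<le> 1 / (ln (1 / \<epsilon>))\<^sup>2 *
             min ((1 - a)\<^sup>2 * b\<^sup>2 / (32 * ln (2 * real k) * ln (exp 1 / \<epsilon>))) (c\<^sup>2)"
    and rows: "\<And>i. i \<in> V \<Longrightarrow> real k * ip V (h i) (h i) \<le> real (card V) * (a * b / ln (1 / \<epsilon>))"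
    and main: "sqrt b + sqrt (2 * a * b) + sqrt c + 2 * real k / real (card V) * \<Lambda>
           \<le> exp (- 1 / 4) * \<delta> / (6 * sqrt 2)"
  shows "real (card {I \<in> ksubsets V k. \<not> block_bound h (\<delta>\<^sup>2) I I}) \<le> real (card V choose k) * \<epsilon>"
proof -
  define N where "N = card V"
  define L where "L = ln (1 / \<epsilon>)"
  define \<kappa> where "\<kappa> = real k * \<Lambda> / real N"
  define n where "n = k - k div 2"
  define n' where "n' = k div 2"
  have n: "n + n' = k" "0 < n" "0 < n'" "2 * n' \<le> k" "3 * n \<le> 2 * k"
    using k(1) unfolding n_def n'_def by auto
  have n0: "0 < real N" "0 < real k" using k unfolding N_def by auto
  \<comment> \<open>With the rational bounds \<open>4 / 5\<close> and \<open>7 / 5\<close> the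
    constant in \<open>main\<close> becomes \<open>2 / 21\<close>.\<close>
  have e4: "exp (- 1 / 4 :: real) \<le> 4 / 5"
  proof -
    have "5 / 4 \<le> exp (1 / 4 :: real)" using exp_ge_add_one_self[of "1 / 4 :: real"] by simp
    then have "inverse (exp (1 / 4 :: real)) \<le> inverse (5 / 4)" by (rule le_imp_inverse_le) simp
    then show ?thesis by (simp add: exp_minus[symmetric])
  qed
  have s2: "7 / 5 \<le> sqrt (2 :: real)" by (rule real_le_rsqrt) (simp add: power2_eq_square)
  have q: "exp (- 1 / 4) * \<delta> / (6 * sqrt 2) \<le> (4 / 5) * \<delta> / (6 * (7 / 5))"
    using e4 s2 \<delta> by (intro frac_le mult_right_mono mult_left_mono) auto
  then have main': "sqrt b + sqrt (2 * a * b) + sqrt c + 2 * \<kappa> \<le> 2 * \<delta> / 21"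
  proof -
    have eq: "2 * real k / real (card V) * \<Lambda> = 2 * \<kappa>" unfolding \<kappa>_def N_def by simp
    have "sqrt b + sqrt (2 * a * b) + sqrt c + 2 * \<kappa> \<le> (4 / 5) * \<delta> / (6 * (7 / 5))"
      using order_trans[OF main q] unfolding eq .
    also have "(4 / 5) * \<delta> / (6 * (7 / 5)) = 2 * \<delta> / 21" by simp
    finally show ?thesis .
  qed
  have \<kappa>0: "0 \<le> \<kappa>" unfolding \<kappa>_def using \<Lambda>(2) by simp
  have sq: "0 < sqrt b" "0 \<le> sqrt (2 * a * b)" "0 < sqrt c" using abc by auto
  \<comment> \<open>As \<Lambda> is at least 1, the numerical condition forces \<open>k / N\<close>
    below \<open>1 / 21\<close>, so \<open>K\<close> is comparable with \<open>N\<close>.\<close>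
  have kN: "20 * real k \<le> real N"
  proof -
    have "real k * 1 / real N \<le> \<kappa>" unfolding \<kappa>_def using \<Lambda>(2) n0 by (intro divide_right_mono mult_left_mono) auto
    moreover have "\<kappa> \<le> 1 / 20" using main' sq \<delta> by linarith
    ultimately have "real k / real N \<le> 1 / 20" by (simp only: mult_1_right)
    then show ?thesis using n0 by (simp add: field_simps)
  qed
  define K where "K = real N - real k"
  have K: "0 < K" "19 * real N \<le> 20 * K" using kN n0 unfolding K_def by auto
  have k\<epsilon>: "real k * \<epsilon> < 1" using \<epsilon> n0 by (simp add: field_simps)
  have \<epsilon>L: "\<epsilon> = exp (- L)" unfolding L_def using \<epsilon> by (simp add: ln_div)
  have \<epsilon>2: "\<epsilon> \<le> 1 / 2"
  proof -
    have "1 / real k \<le> 1 / 2" using k by (intro divide_left_mono) auto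
    then show ?thesis using \<epsilon> by simp
  qed
  have L: "2 / 3 \<le> L"
  proof -
    have "ln 2 \<le> L" unfolding L_def using \<epsilon> \<epsilon>2 by (subst ln_le_cancel_iff) (auto simp: field_simps)
    then show ?thesis using ln2_ge_two_thirds by linarith
  qed
  have eL: "ln (exp 1 / \<epsilon>) = 1 + L" unfolding L_def using \<epsilon> by (simp add: ln_div)
  \<comment> \<open>The full squared row norm allowed by \<open>rows\<close>: the fraction
    \<open>a\<close> of the cap \<open>b / L\<close>, scaled up by \<open>N / k\<close>.\<close>
  define \<rho> where "\<rho> = real N * a * b / (real k * L)"
  have \<rho>0: "0 < \<rho>" unfolding \<rho>_def using n0 abc L by simp
  have \<rho>: "ip V (h i) (h i) \<le> \<rho>" if "i \<in> V" for i
    using rows[OF that] n0 L unfolding \<rho>_def N_def[symmetric] L_def[symmetric] by (simp add: field_simps)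
  define t1 where "t1 = 2 * real n * (\<Lambda>\<^sup>2 / K) + (9 * L) * \<rho>"
  have t1: "0 \<le> t1" unfolding t1_def using K L \<rho>0 by simp
  \<comment> \<open>A square, so that \<open>sqrt t2\<close> is three times a sum occurring in
    \<open>main\<close>. Doubled by decoupling it is at most \<open>6 * 2 / 21 = 4 / 7\<close> of
    \<delta>, which leaves \<open>3 / 7\<close> for the exceptional event.\<close>
  define t2 where "t2 = 9 * (2 * \<kappa> + sqrt (2 * a * b) + sqrt b)\<^sup>2"
  have t20: "0 \<le> t2" unfolding t2_def by simp
  have st2: "sqrt t2 = 3 * (2 * \<kappa> + sqrt (2 * a * b) + sqrt b)"
    unfolding t2_def using \<kappa>0 sq by (simp add: real_sqrt_mult)
  have st2': "2 * sqrt t2 \<le> 4 / 7 * \<delta>"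
  proof -
    have "p + q + r + 2 * w \<le> 2 * d / 21 \<Longrightarrow> 0 \<le> r \<Longrightarrow> 2 * (3 * (2 * w + q + p)) \<le> 4 / 7 * d"
      for p q r w d :: real by (simp add: field_simps)
    from this[OF main' less_imp_le[OF sq(3)]] show ?thesis unfolding st2 .
  qed
  \<comment> \<open>\<Lambda> has passed through both steps and leaves
    \<open>(k * \<Lambda> / K)\<^sup>2\<close>; \<rho> has passed through one and leaves a multiple
    of \<open>a * b\<close>; the cap leaves \<open>9 * b\<close>, its \<open>L\<close>
    cancelling.\<close>
  have t2: "2 * real n' * (t1 / K) + (9 * L) * (b / L) \<le> t2"
  proof -
    have Lr: "(9 * L) * \<rho> = 9 * real N * a * b / real k" unfolding \<rho>_def using L by simp
    have "t1 \<le> 2 * real k * (\<Lambda>\<^sup>2 / K) + 9 * real N * a * b / real k"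
      unfolding t1_def Lr using n K by (intro add_right_mono mult_right_mono) auto
    then have "2 * real n' * (t1 / K) \<le> real k * ((2 * real k * (\<Lambda>\<^sup>2 / K) + 9 * real N * a * b / real k) / K)"
      using n K t1 by (intro mult_mono divide_right_mono) auto
    also have "\<dots> = 2 * (real k * \<Lambda> / K)\<^sup>2 + 9 * (real N / K) * (a * b)"
      using n0 K by (simp add: field_simps power2_eq_square)
    also have "\<dots> \<le> 2 * (2 * \<kappa>)\<^sup>2 + 9 * 2 * (a * b)"
    proof (intro add_mono mult_left_mono mult_right_mono power_mono)
      have "real k * \<Lambda> / K \<le> real k * \<Lambda> / (real N / 2)"
        using K n0 \<Lambda>(2) by (intro divide_left_mono) auto
      then show "real k * \<Lambda> / K \<le> 2 * \<kappa>" unfolding \<kappa>_def by (simp add: mult.commute)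
      show "real N / K \<le> 2" using K by (simp add: field_simps)
    qed (use abc K \<Lambda>(2) in auto)
    also have "\<dots> \<le> 9 * ((2 * \<kappa>)\<^sup>2 + 2 * a * b)" using abc by simp
    finally have "2 * real n' * (t1 / K) + (9 * L) * (b / L) \<le> 9 * ((2 * \<kappa>)\<^sup>2 + 2 * a * b + b)"
      using L by simp
    also have "(2 * \<kappa>)\<^sup>2 + 2 * a * b + b = (2 * \<kappa>)\<^sup>2 + (sqrt (2 * a * b))\<^sup>2 + (sqrt b)\<^sup>2"
      using abc by simp
    also have "\<dots> \<le> (2 * \<kappa> + sqrt (2 * a * b) + sqrt b)\<^sup>2"
    proof -
      have "0 \<le> (2 * \<kappa>) * sqrt (2 * a * b)" "0 \<le> (2 * \<kappa>) * sqrt b" "0 \<le> sqrt (2 * a * b) * sqrt b"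
        using \<kappa>0 sq by simp_all
      then show ?thesis by (simp only: power2_eq_square distrib_left distrib_right mult.commute)
    qed
    finally show ?thesis unfolding t2_def by simp
  qed
  \<comment> \<open>The factor 8 is the 32 of the coherence hypothesis divided by the 4 required in
    \<open>row_norm_tail\<close>.\<close>
  define Z where "Z = 8 * ln (2 * real k) * (1 + L)"
  have Z: "8 * L + 2 \<le> Z"
  proof -
    have "ln 4 \<le> ln (2 * real k)" using k by simp
    moreover have "ln 4 = 2 * ln (2 :: real)" using ln_realpow[of 2 2] by simp
    ultimately have "1 \<le> ln (2 * real k)" using ln2_ge_two_thirds by linarith
    then have "8 * 1 * (1 + L) \<le> Z" unfolding Z_def using L by (intro mult_right_mono mult_left_mono) auto
    then show ?thesis by simp
  qed
  have Z\<mu>: "Z * (4 * real k * \<mu> ^ 4) \<le> (1 - a)\<^sup>2 * (b / L)\<^sup>2"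
  proof -
    have lnk: "0 < ln (2 * real k)" using k by simp
    have D: "0 < 32 * ln (2 * real k) * (1 + L)" using lnk L by simp
    have "real k * \<mu> ^ 4 \<le> 1 / L\<^sup>2 * min ((1 - a)\<^sup>2 * b\<^sup>2 / (32 * ln (2 * real k) * (1 + L))) (c\<^sup>2)"
      using k\<mu> unfolding L_def[symmetric] eL .
    also have "\<dots> \<le> 1 / L\<^sup>2 * ((1 - a)\<^sup>2 * b\<^sup>2 / (32 * ln (2 * real k) * (1 + L)))"
      by (intro mult_left_mono) auto
    finally have "real k * \<mu> ^ 4 \<le> (1 - a)\<^sup>2 * (b / L)\<^sup>2 / (32 * ln (2 * real k) * (1 + L))"
      by (simp add: power_divide mult_ac)
    then have "(32 * ln (2 * real k) * (1 + L)) * (real k * \<mu> ^ 4) \<le> (1 - a)\<^sup>2 * (b / L)\<^sup>2"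
      using D by (simp only: pos_le_divide_eq mult.commute)
    then show ?thesis unfolding Z_def by (simp add: mult_ac)
  qed
  \<comment> \<open>The role of \<open>c\<close>: the second entry of the minimum gives
    \<open>\<mu>\<^sup>2 \<le> c / L\<close>, and \<open>main\<close> gives
    \<open>sqrt c \<le> 2 * \<delta> / 21\<close>.\<close>
  have \<mu>\<delta>: "\<mu> \<le> \<delta> / 7"
  proof -
    have "1 * \<mu> ^ 4 \<le> real k * \<mu> ^ 4" using k by (intro mult_right_mono) auto
    also have "\<dots> \<le> 1 / L\<^sup>2 * min ((1 - a)\<^sup>2 * b\<^sup>2 / (32 * ln (2 * real k) * (1 + L))) (c\<^sup>2)"
      using k\<mu> unfolding L_def[symmetric] eL .
    also have "\<dots> \<le> 1 / L\<^sup>2 * c\<^sup>2" by (intro mult_left_mono) auto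
    finally have "(\<mu>\<^sup>2)\<^sup>2 \<le> (c / L)\<^sup>2" by (simp add: power_divide flip: power_mult)
    then have "\<mu>\<^sup>2 \<le> c / L" by (rule power2_le_imp_le) (use abc L in simp)
    also have "\<dots> \<le> c / (2 / 3)" using abc L by (intro divide_left_mono) auto
    also have "\<dots> = 3 / 2 * (sqrt c)\<^sup>2" using abc by simp
    also have "\<dots> \<le> 3 / 2 * (2 * \<delta> / 21)\<^sup>2"
      using main' sq \<kappa>0 by (intro mult_left_mono power_mono) linarith+
    also have "\<dots> \<le> (\<delta> / 7)\<^sup>2" by (simp add: power2_eq_square)
    finally show ?thesis by (rule power2_le_imp_le) (use \<delta> in simp)
  qed
  define \<eta>0 where "\<eta>0 = exp (1 - 9 * L)"
  define \<eta>3 where "\<eta>3 = 2 * real n * exp (- Z)"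
  have s: "1 \<le> 9 * L" using L by simp
  have bound: "(\<Sum>J\<in>ksubsets V n. real (card {A \<in> ksubsets (V - J) n'. \<not> block_bound h t2 A J}))
    \<le> real (card V choose n) * real ((card V - n) choose n') * (real n * \<eta>0 + real n' * \<eta>0 + real n' * \<eta>3)"
  proof (rule bad_block_count[OF V])
    show "n + n' < card V" using n(1) kN n0 unfolding N_def by linarith
    show "0 < n'" by (rule n)
    show "real (card {J \<in> ksubsets V n. \<not> block_bound h t1 V J}) \<le> real (card V choose n) * (real n * \<eta>0)"
      unfolding \<eta>0_def
    proof (rule column_sampling_tail[OF V sym \<rho> \<rho>0 \<Lambda>(1) _ K(1) _ _ s])
      show "K + real n \<le> real (card V) + 1" using n(1) unfolding K_def N_def by linarith
      show "2 * real n * (\<Lambda>\<^sup>2 / K) + (9 * L) * \<rho> \<le> t1" unfolding t1_def ..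
    qed auto
    show "real (card {A \<in> ksubsets (V - J) n'. (\<forall>i\<in>A. ip J (h i) (h i) \<le> b / L) \<and> \<not> block_bound h t2 A J})
        \<le> real (card (V - J) choose n') * (real n' * \<eta>0)" if J: "J \<in> ksubsets V n" "block_bound h t1 V J" for J
      unfolding \<eta>0_def
    proof (rule row_sampling_tail[OF V _ _ J(2) t1 K(1) _ t2 s])
      show JV: "J \<subseteq> V" using J by (simp add: ksubsets_def)
      show "0 < b / L" using abc L by simp
      have "card (V - J) = N - n" "n \<le> N"
        using J JV V k n(1) ksubsets_finite[OF V J(1)] unfolding N_def ksubsets_def by (auto simp: card_Diff_subset)
      then show "K + real n' \<le> real (card (V - J)) + 1" using n(1) unfolding K_def by (simp add: of_nat_diff)
    qed
    show "real (card {J \<in> ksubsets (V - {i}) n. b / L < ip J (h i) (h i)}) \<le> real ((card V - 1) choose n) * \<eta>3" if i: "i \<in> V" for i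
      unfolding \<eta>3_def
    proof (rule row_norm_tail[where a = a and K = K and \<rho> = \<rho> and \<mu> = \<mu> and k = "real k" and t = "b / L"])
      show "K + real n \<le> real (card V)" using n(1) unfolding K_def N_def by linarith
      show "real n * (\<rho> / K) \<le> a * (b / L)"
      proof -
        \<comment> \<open>The larger half has at most \<open>2 / 3\<close> of the \<open>k\<close>
          indices, also for odd \<open>k\<close>; this makes up for \<open>K\<close> being smaller
          than \<open>N\<close>.\<close>
        have "real n * (\<rho> / K) \<le> (2 / 3 * real k) * (\<rho> / (2 / 3 * real N))"
          using n(5) K n0 \<rho>0 by (intro mult_mono divide_left_mono) auto
        also have "\<dots> = a * (b / L)" unfolding \<rho>_def using n0 L by (simp add: field_simps)
        finally show ?thesis .
      qed
      show "Z * (4 * real k * \<mu> ^ 4) \<le> (1 - a)\<^sup>2 * (b / L)\<^sup>2" by (rule Z\<mu>)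
      show "\<bar>h i j\<bar> \<le> \<mu>" if "j \<in> V" for j by (rule \<mu>(1)[OF i that])
      show "ip V (h i) (h i) \<le> \<rho>" by (rule \<rho>[OF i])
    qed (use V i abc L \<rho>0 Z n(1) K(1) in auto)
  qed (auto simp: \<eta>0_def)
  have "real (card {I \<in> ksubsets V k. \<not> block_bound h (\<delta>\<^sup>2) I I}) * (\<delta> - 2 * sqrt t2)
    \<le> real (card V choose k) * (real k * \<mu> * (real n * \<eta>0 + real n' * \<eta>0 + real n' * \<eta>3))"
    using bound st2' \<delta> unfolding n_def n'_def
    by (intro decoupled_count V k sym diag \<mu> t20) auto
  also have "\<dots> \<le> real (card V choose k) * (3 / 7 * \<delta> * \<epsilon>)"
  proof (rule mult_left_mono)
    \<comment> \<open>The constant 1 in the exponent is absorbed by \<open>3 * L\<close>.\<close>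
    have "\<eta>0 \<le> exp (- (6 * L))" unfolding \<eta>0_def using L by simp
    also have "\<dots> = \<epsilon> ^ 6" unfolding \<epsilon>L by (simp add: exp_of_nat_mult[symmetric])
    finally have \<eta>0: "\<eta>0 \<le> \<epsilon> ^ 6" .
    have "exp (- Z) \<le> exp (- (8 * L))" using Z by simp
    also have "\<dots> = \<epsilon> ^ 8" unfolding \<epsilon>L by (simp add: exp_of_nat_mult[symmetric])
    finally have "\<eta>3 \<le> 2 * real k * \<epsilon> ^ 8" unfolding \<eta>3_def using n by (intro mult_mono) auto
    also have "\<dots> = 2 * (real k * \<epsilon>) * \<epsilon> ^ 7" by (simp add: numeral_eq_Suc)
    also have "\<dots> \<le> 2 * 1 * \<epsilon> ^ 7" using k\<epsilon> \<epsilon> by (intro mult_right_mono mult_left_mono) auto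
    also have "\<dots> = 2 * \<epsilon> * \<epsilon> ^ 6" by (simp add: numeral_eq_Suc)
    also have "\<dots> \<le> 1 * \<epsilon> ^ 6" using \<epsilon>2 \<epsilon> by (intro mult_right_mono) auto
    finally have \<eta>3: "\<eta>3 \<le> \<epsilon> ^ 6" by simp
    have "real n * \<eta>0 + real n' * \<eta>0 + real n' * \<eta>3 \<le> real n * \<epsilon> ^ 6 + real n' * \<epsilon> ^ 6 + real n' * \<epsilon> ^ 6"
      using \<eta>0 \<eta>3 by (intro add_mono mult_left_mono) auto
    also have "\<dots> = (real n + real n' + real n') * \<epsilon> ^ 6" by (simp add: algebra_simps)
    also have "\<dots> \<le> (2 * real k) * \<epsilon> ^ 6" using n \<epsilon> by (intro mult_right_mono) auto
    finally have "real k * \<mu> * (real n * \<eta>0 + real n' * \<eta>0 + real n' * \<eta>3) \<le> real k * (\<delta> / 7) * ((2 * real k) * \<epsilon> ^ 6)"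
      using \<mu>\<delta> \<mu>(2) \<delta> \<epsilon> by (intro mult_mono mult_left_mono) (auto simp: \<eta>0_def \<eta>3_def)
    \<comment> \<open>One factor \<open>k\<close> comes from the entrywise bound and one from the
      failure estimates; each is paid by \<open>k * \<epsilon> < 1\<close>, leaving four powers of
      \<epsilon>.\<close>
    also have "\<dots> = 2 / 7 * \<delta> * ((real k * \<epsilon>) * (real k * \<epsilon>)) * (\<epsilon> ^ 3 * \<epsilon>)" by (simp add: numeral_eq_Suc)
    also have "\<dots> \<le> 2 / 7 * \<delta> * (1 * 1) * (1 * \<epsilon>)"
      using k\<epsilon> \<epsilon> \<epsilon>2 \<delta> by (intro mult_mono mult_left_mono power_le_one) auto
    also have "\<dots> \<le> 3 / 7 * \<delta> * \<epsilon>" using \<delta> \<epsilon> by simp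
    finally show "real k * \<mu> * (real n * \<eta>0 + real n' * \<eta>0 + real n' * \<eta>3) \<le> 3 / 7 * \<delta> * \<epsilon>" .
  qed simp
  finally have fin: "real (card {I \<in> ksubsets V k. \<not> block_bound h (\<delta>\<^sup>2) I I}) * (\<delta> - 2 * sqrt t2)
    \<le> real (card V choose k) * (3 / 7 * \<delta> * \<epsilon>)" .
  have "real (card {I \<in> ksubsets V k. \<not> block_bound h (\<delta>\<^sup>2) I I}) * (3 / 7 * \<delta>)
    \<le> real (card {I \<in> ksubsets V k. \<not> block_bound h (\<delta>\<^sup>2) I I}) * (\<delta> - 2 * sqrt t2)"
    using st2' by (intro mult_left_mono) auto
  also note fin
  finally have fin2: "real (card {I \<in> ksubsets V k. \<not> block_bound h (\<delta>\<^sup>2) I I}) * (3 / 7 * \<delta>)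
    \<le> (real (card V choose k) * \<epsilon>) * (3 / 7 * \<delta>)" by (simp add: mult_ac)
  have "0 < 3 / 7 * \<delta>" using \<delta> by simp
  then show ?thesis by (rule mult_right_le_imp_le[OF fin2])
qed

section \<open>Random column submatrices\<close>

lemma l2_norm_vec_sum: "l2_norm_vec x = sqrt (\<Sum>i<dim_vec x. (x $ i)\<^sup>2)"
  unfolding l2_norm_vec_def scalar_prod_def by (simp add: power2_eq_square lessThan_atLeast0)

lemma l2_norm_vec_nonneg: "0 \<le> l2_norm_vec x"
  unfolding l2_norm_vec_sum by (simp add: sum_nonneg)

lemma l2_norm_vec_smult: "l2_norm_vec (c \<cdot>\<^sub>v x) = \<bar>c\<bar> * l2_norm_vec x"
  unfolding l2_norm_vec_sum by (simp add: power_mult_distrib real_sqrt_mult flip: sum_distrib_left)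

lemma mult_mat_vec_nth: "i < dim_row A \<Longrightarrow> dim_vec x = dim_col A \<Longrightarrow> (A *\<^sub>v x) $ i = (\<Sum>j<dim_col A. A $$ (i, j) * x $ j)"
  by (simp add: scalar_prod_def lessThan_atLeast0)

lemma spectral_norm_le:
  assumes d: "0 \<le> d" and b: "\<And>x. x \<in> carrier_vec (dim_col A) \<Longrightarrow> l2_norm_vec (A *\<^sub>v x) \<le> d * l2_norm_vec x"
  shows "spectral_norm A \<le> d"
  unfolding spectral_norm_def
proof (rule cSup_least)
  have "0\<^sub>v (dim_col A) \<in> carrier_vec (dim_col A)" "l2_norm_vec (0\<^sub>v (dim_col A)) \<le> 1"
    by (simp_all add: l2_norm_vec_sum)
  then show "{l2_norm_vec (A *\<^sub>v x) |x. x \<in> carrier_vec (dim_col A) \<and> l2_norm_vec x \<le> 1} \<noteq> {}" by blast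
next
  fix y assume "y \<in> {l2_norm_vec (A *\<^sub>v x) |x. x \<in> carrier_vec (dim_col A) \<and> l2_norm_vec x \<le> 1}"
  then obtain x where x: "x \<in> carrier_vec (dim_col A)" "l2_norm_vec x \<le> 1" "y = l2_norm_vec (A *\<^sub>v x)" by blast
  have "y \<le> d * l2_norm_vec x" using b x by simp
  also have "\<dots> \<le> d" using x(2) d by (rule mult_left_le)
  finally show "y \<le> d" .
qed

text \<open>The Frobenius norm supplies the upper bound that makes the supremum in
  \<open>spectral_norm\<close> meaningful.\<close>

lemma mult_mat_vec_Frobenius:
  assumes x: "x \<in> carrier_vec (dim_col A)"
  shows "l2_norm_vec (A *\<^sub>v x) \<le> sqrt (\<Sum>i<dim_row A. \<Sum>j<dim_col A. (A $$ (i, j))\<^sup>2) * l2_norm_vec x"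
proof -
  have "(\<Sum>i<dim_row A. ((A *\<^sub>v x) $ i)\<^sup>2) \<le> (\<Sum>i<dim_row A. (\<Sum>j<dim_col A. (A $$ (i, j))\<^sup>2) * (\<Sum>j<dim_col A. (x $ j)\<^sup>2))"
  proof (rule sum_mono)
    fix i assume "i \<in> {..<dim_row A}"
    then have "(A *\<^sub>v x) $ i = (\<Sum>j<dim_col A. A $$ (i, j) * x $ j)" using x by (intro mult_mat_vec_nth) auto
    then show "((A *\<^sub>v x) $ i)\<^sup>2 \<le> (\<Sum>j<dim_col A. (A $$ (i, j))\<^sup>2) * (\<Sum>j<dim_col A. (x $ j)\<^sup>2)"
      by (simp only: Cauchy_Schwarz_ineq_sum)
  qed
  then have "(\<Sum>i<dim_row A. ((A *\<^sub>v x) $ i)\<^sup>2) \<le> (\<Sum>i<dim_row A. \<Sum>j<dim_col A. (A $$ (i, j))\<^sup>2) * (\<Sum>j<dim_col A. (x $ j)\<^sup>2)"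
    by (simp add: sum_distrib_right)
  then have "sqrt (\<Sum>i<dim_row A. ((A *\<^sub>v x) $ i)\<^sup>2) \<le> sqrt ((\<Sum>i<dim_row A. \<Sum>j<dim_col A. (A $$ (i, j))\<^sup>2) * (\<Sum>j<dim_col A. (x $ j)\<^sup>2))"
    by (rule real_sqrt_le_mono)
  moreover have "dim_vec x = dim_col A" using x by auto
  ultimately show ?thesis unfolding l2_norm_vec_sum by (simp add: real_sqrt_mult)
qed

lemma spectral_norm_bound:
  assumes x: "x \<in> carrier_vec (dim_col A)"
  shows "l2_norm_vec (A *\<^sub>v x) \<le> spectral_norm A * l2_norm_vec x"
proof (cases "l2_norm_vec x = 0")
  case True
  then show ?thesis using mult_mat_vec_Frobenius[OF x] by simp
next
  case False
  define c where "c = l2_norm_vec x"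
  have c: "0 < c" using False l2_norm_vec_nonneg[of x] unfolding c_def by simp
  define z where "z = (1 / c) \<cdot>\<^sub>v x"
  have z: "z \<in> carrier_vec (dim_col A)" "l2_norm_vec z = 1"
    using x c unfolding z_def by (simp_all add: l2_norm_vec_smult c_def)
  define F where "F = sqrt (\<Sum>i<dim_row A. \<Sum>j<dim_col A. (A $$ (i, j))\<^sup>2)"
  have F0: "0 \<le> F" unfolding F_def by (simp add: sum_nonneg)
  have "l2_norm_vec (A *\<^sub>v z) \<le> spectral_norm A"
    unfolding spectral_norm_def
  proof (rule cSup_upper)
    show "l2_norm_vec (A *\<^sub>v z) \<in> {l2_norm_vec (A *\<^sub>v x) |x. x \<in> carrier_vec (dim_col A) \<and> l2_norm_vec x \<le> 1}"
      using z by (auto intro!: exI[of _ z])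
    have "l2_norm_vec (A *\<^sub>v w) \<le> F" if "w \<in> carrier_vec (dim_col A)" "l2_norm_vec w \<le> 1" for w
      using mult_mat_vec_Frobenius[OF that(1)] mult_left_le[OF that(2) F0] unfolding F_def by linarith
    then show "bdd_above {l2_norm_vec (A *\<^sub>v x) |x. x \<in> carrier_vec (dim_col A) \<and> l2_norm_vec x \<le> 1}"
      by (intro bdd_aboveI[of _ F]) auto
  qed
  also have "A *\<^sub>v z = (1 / c) \<cdot>\<^sub>v (A *\<^sub>v x)"
    unfolding z_def using x by (intro mult_mat_vec) auto
  finally show ?thesis using c unfolding l2_norm_vec_smult c_def[symmetric] by (simp add: field_simps)
qed

lemma block_bound_spectral_norm:
  assumes A: "A \<in> carrier_mat m N"
  shows "block_bound (\<lambda>i j. A $$ (i, j)) ((spectral_norm A)\<^sup>2) {..<m} {..<N}"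
  unfolding block_bound_def
proof
  fix y :: "nat \<Rightarrow> real"
  have x: "vec N y \<in> carrier_vec (dim_col A)" using A by simp
  have "(A *\<^sub>v vec N y) $ i = ip {..<N} (\<lambda>j. A $$ (i, j)) y" if "i < m" for i
    unfolding ip_def using A that by (subst mult_mat_vec_nth) auto
  then have "l2_norm_vec (A *\<^sub>v vec N y) = sqrt (\<Sum>i<m. (ip {..<N} (\<lambda>j. A $$ (i, j)) y)\<^sup>2)"
    unfolding l2_norm_vec_sum using A by simp
  moreover have "l2_norm_vec (vec N y) = sqrt (ip {..<N} y y)"
    unfolding l2_norm_vec_sum ip_def by (simp add: power2_eq_square)
  ultimately have "sqrt (\<Sum>i<m. (ip {..<N} (\<lambda>j. A $$ (i, j)) y)\<^sup>2) \<le> spectral_norm A * sqrt (ip {..<N} y y)"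
    using spectral_norm_bound[OF x] by simp
  then have "(sqrt (\<Sum>i<m. (ip {..<N} (\<lambda>j. A $$ (i, j)) y)\<^sup>2))\<^sup>2 \<le> (spectral_norm A * sqrt (ip {..<N} y y))\<^sup>2"
    by (intro power_mono) (simp_all add: sum_nonneg)
  then show "(\<Sum>i<m. (ip {..<N} (\<lambda>j. A $$ (i, j)) y)\<^sup>2) \<le> (spectral_norm A)\<^sup>2 * ip {..<N} y y"
    by (simp add: sum_nonneg ip_nonneg power_mult_distrib)
qed

text \<open>For unit columns this is the Gram matrix minus the identity. A diagonal that is zero by
  definition makes \<open>hollow_gram_diag\<close> hold for every index, even beyond the last
  column.\<close>

definition hollow_gram :: "real mat \<Rightarrow> nat \<Rightarrow> nat \<Rightarrow> real" where
  "hollow_gram \<Phi> i j = (if i = j then 0 else scalar_prod (col \<Phi> i) (col \<Phi> j))"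

lemma hollow_gram_sym: "hollow_gram \<Phi> i j = hollow_gram \<Phi> j i"
  unfolding hollow_gram_def using comm_scalar_prod[of "col \<Phi> i" "dim_row \<Phi>" "col \<Phi> j"] by simp

lemma hollow_gram_diag: "hollow_gram \<Phi> i i = 0"
  unfolding hollow_gram_def by simp

lemma unit_norm_columns_scalar_prod:
  "unit_norm_columns \<Phi> \<Longrightarrow> j < dim_col \<Phi> \<Longrightarrow> scalar_prod (col \<Phi> j) (col \<Phi> j) = 1"
  unfolding unit_norm_columns_def l2_norm_vec_def by (metis real_sqrt_eq_1_iff)

lemma scalar_prod_col:
  assumes "\<Phi> \<in> carrier_mat m N" "i < N" "j < N"
  shows "scalar_prod (col \<Phi> i) (col \<Phi> j) = (\<Sum>r<m. \<Phi> $$ (r, i) * \<Phi> $$ (r, j))"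
  using assms by (simp add: scalar_prod_def lessThan_atLeast0)

lemma spectral_norm_ge_1:
  assumes \<Phi>: "\<Phi> \<in> carrier_mat m N" "unit_norm_columns \<Phi>" and N: "0 < N"
  shows "1 \<le> (spectral_norm \<Phi>)\<^sup>2"
proof -
  have u: "ip {..<N} x (unit_fun 0) = x 0" for x
  proof -
    \<comment> \<open>A dummy family: only the coordinate rule \<open>ip_unit'\<close> is
      wanted.\<close>
    interpret finite_family "{..<N}" "\<lambda>_ _. 0" by standard simp
    show ?thesis using N by (intro ip_unit') simp
  qed
  have "(\<Sum>i<m. (ip {..<N} (\<lambda>j. \<Phi> $$ (i, j)) (unit_fun 0))\<^sup>2) \<le> (spectral_norm \<Phi>)\<^sup>2 * ip {..<N} (unit_fun 0) (unit_fun 0)"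
    using block_bound_spectral_norm[OF \<Phi>(1)] unfolding block_bound_def by blast
  moreover have "(\<Sum>i<m. (\<Phi> $$ (i, 0))\<^sup>2) = 1"
    using unit_norm_columns_scalar_prod[OF \<Phi>(2), of 0] scalar_prod_col[OF \<Phi>(1) N N] \<Phi>(1) N
    by (simp add: power2_eq_square)
  ultimately show ?thesis unfolding u by simp
qed

text \<open>On the whole index set \<open>h = \<Phi>\<^sup>T\<Phi> - Id\<close>, whose spectrum lies in \<open>[-1, \<parallel>\<Phi>\<parallel>\<^sup>2 - 1]\<close>.\<close>
lemma block_bound_hollow_gram:
  assumes \<Phi>: "\<Phi> \<in> carrier_mat m N" "unit_norm_columns \<Phi>" and N: "0 < N"
  shows "block_bound (hollow_gram \<Phi>) (((spectral_norm \<Phi>)\<^sup>2)\<^sup>2) {..<N} {..<N}"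
  unfolding block_bound_def
proof
  fix y :: "nat \<Rightarrow> real"
  define \<Lambda> where "\<Lambda> = (spectral_norm \<Phi>)\<^sup>2"
  have \<Lambda>1: "1 \<le> \<Lambda>" unfolding \<Lambda>_def by (rule spectral_norm_ge_1[OF assms])
  define p where "p r j = \<Phi> $$ (r, j)" for r j
  have bp: "block_bound p \<Lambda> {..<m} {..<N}"
    unfolding p_def \<Lambda>_def by (rule block_bound_spectral_norm[OF \<Phi>(1)])
  have bpT: "block_bound (\<lambda>j r. p r j) \<Lambda> {..<N} {..<m}"
    by (rule block_bound_transpose[where h' = p]) (use bp \<Lambda>1 in \<open>auto simp: block_bound_def\<close>)
  define z where "z r = ip {..<N} (p r) y" for r
  define g where "g i = ip {..<m} (\<lambda>r. p r i) z" for i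
  have zz: "ip {..<m} z z \<le> \<Lambda> * ip {..<N} y y"
    using bp unfolding block_bound_def z_def ip_def[of "{..<m}"] by (simp add: power2_eq_square)
  have gg: "ip {..<N} g g \<le> \<Lambda> * ip {..<m} z z"
    using bpT unfolding block_bound_def g_def ip_def[of "{..<N}"] by (simp add: power2_eq_square)
  have yg: "ip {..<N} y g = ip {..<m} z z"
  proof -
    have "ip {..<N} y g = (\<Sum>i<N. \<Sum>r<m. y i * (p r i * z r))"
      unfolding ip_def g_def by (simp add: sum_distrib_left)
    also have "\<dots> = (\<Sum>r<m. (\<Sum>i<N. p r i * y i) * z r)"
      unfolding sum_distrib_right by (subst sum.swap) (simp add: mult_ac)
    finally show ?thesis unfolding ip_def z_def .
  qed
  have hg: "ip {..<N} (hollow_gram \<Phi> i) y = g i - y i" if i: "i < N" for i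
  proof -
    have "g i = (\<Sum>r<m. \<Sum>j<N. p r i * (p r j * y j))"
      unfolding g_def z_def ip_def by (simp add: sum_distrib_left)
    also have "\<dots> = (\<Sum>j<N. (\<Sum>r<m. p r i * p r j) * y j)"
      unfolding sum_distrib_right by (subst sum.swap) (simp add: mult_ac)
    also have "\<dots> = (\<Sum>j<N. scalar_prod (col \<Phi> i) (col \<Phi> j) * y j)"
      by (intro sum.cong refl) (simp add: scalar_prod_col[OF \<Phi>(1) i] p_def)
    also have "\<dots> = (\<Sum>j<N. hollow_gram \<Phi> i j * y j + (if j = i then y j else 0))"
      using unit_norm_columns_scalar_prod[OF \<Phi>(2)] \<Phi>(1)
      by (intro sum.cong refl) (auto simp: hollow_gram_def)
    also have "\<dots> = ip {..<N} (hollow_gram \<Phi> i) y + y i"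
      unfolding ip_def sum.distrib using i by simp
    finally show ?thesis by simp
  qed
  \<comment> \<open>With \<open>z = \<Phi> y\<close> and \<open>g = \<Phi>\<^sup>T z\<close>, the
    square is at most \<open>\<Lambda> - 2\<close> times the squared length of \<open>z\<close>,
    plus that of \<open>y\<close>. The sign of \<open>\<Lambda> - 2\<close> decides whether the
    upper bound \<open>zz\<close> or nonnegativity is used for \<open>z\<close>.\<close>
  have "(\<Sum>i<N. (ip {..<N} (hollow_gram \<Phi> i) y)\<^sup>2) = (\<Sum>i<N. g i * g i - 2 * (y i * g i) + y i * y i)"
    by (intro sum.cong refl) (simp add: hg power2_eq_square algebra_simps)
  also have "\<dots> = ip {..<N} g g - 2 * ip {..<N} y g + ip {..<N} y y"
    unfolding ip_def by (simp add: sum.distrib sum_subtractf sum_distrib_left)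
  also have "\<dots> \<le> (\<Lambda> - 2) * ip {..<m} z z + ip {..<N} y y"
    unfolding yg using gg by (simp add: algebra_simps)
  also have "\<dots> \<le> \<Lambda>\<^sup>2 * ip {..<N} y y"
  proof (cases "2 \<le> \<Lambda>")
    case True
    then have "(\<Lambda> - 2) * ip {..<m} z z \<le> (\<Lambda> - 2) * (\<Lambda> * ip {..<N} y y)"
      using zz by (intro mult_left_mono) auto
    moreover have "1 * ip {..<N} y y \<le> 2 * \<Lambda> * ip {..<N} y y"
      using True by (intro mult_right_mono ip_nonneg) auto
    ultimately show ?thesis by (simp add: algebra_simps power2_eq_square)
  next
    case False
    then have "(\<Lambda> - 2) * ip {..<m} z z \<le> 0" using ip_nonneg[of "{..<m}" z] by (simp add: mult_nonpos_nonneg)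
    moreover have "1 * ip {..<N} y y \<le> \<Lambda>\<^sup>2 * ip {..<N} y y"
      using \<Lambda>1 by (intro mult_right_mono ip_nonneg) simp
    ultimately show ?thesis by simp
  qed
  finally show "(\<Sum>i<N. (ip {..<N} (hollow_gram \<Phi> i) y)\<^sup>2) \<le> ((spectral_norm \<Phi>)\<^sup>2)\<^sup>2 * ip {..<N} y y"
    unfolding \<Lambda>_def .
qed

text \<open>\<open>pick I\<close> enumerates \<open>I\<close> in increasing order. Up to this
  relabelling of coordinates, which preserves lengths, the matrix is \<open>hollow_gram\<close> on
  \<open>I\<close>.\<close>

lemma spectral_norm_hollow_gram_le:
  assumes \<Phi>: "\<Phi> \<in> carrier_mat m N" "unit_norm_columns \<Phi>"
    and I: "I \<in> ksubsets {..<N} k" and b: "block_bound (hollow_gram \<Phi>) (\<delta>\<^sup>2) I I" and \<delta>: "0 \<le> \<delta>"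
  shows "spectral_norm (transpose_mat (column_submatrix \<Phi> I) * column_submatrix \<Phi> I - 1\<^sub>m k) \<le> \<delta>"
proof -
  define G where "G = transpose_mat (column_submatrix \<Phi> I) * column_submatrix \<Phi> I - 1\<^sub>m k"
  have IN: "I \<subseteq> {..<N}" "card I = k" "finite I"
    using I ksubsets_finite[OF _ I] by (auto simp: ksubsets_def)
  have dims: "card {i. i < dim_row \<Phi> \<and> i \<in> UNIV} = m" "card {j. j < dim_col \<Phi> \<and> j \<in> I} = k"
  proof -
    have "{j. j < dim_col \<Phi> \<and> j \<in> I} = I" using IN \<Phi>(1) by auto
    then show "card {j. j < dim_col \<Phi> \<and> j \<in> I} = k" using IN by simp
  qed (use \<Phi>(1) in simp)
  have sub: "column_submatrix \<Phi> I \<in> carrier_mat m k"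
    unfolding column_submatrix_def using dims by (intro carrier_matI) (simp_all add: dim_submatrix)
  have sub_nth: "column_submatrix \<Phi> I $$ (r, q) = \<Phi> $$ (r, pick I q)" if "r < m" "q < k" for r q
    unfolding column_submatrix_def using that dims by (subst submatrix_index) (simp_all add: pick_UNIV)
  have pin: "pick I q \<in> I" if "q < k" for q using that IN by (intro pick_in_set_le) simp
  have pinj: "inj_on (pick I) {..<k}"
  proof (rule linorder_inj_onI)
    fix x y assume "x < y" "x \<in> {..<k}" "y \<in> {..<k}"
    then have "pick I x < pick I y" using IN by (intro pick_mono_le) auto
    then show "pick I x \<noteq> pick I y" by simp
  qed auto
  have "pick I ` {..<k} = I"
    using pin pinj IN by (intro card_subset_eq) (auto simp: card_image)
  then have bij: "bij_betw (pick I) {..<k} I" using pinj unfolding bij_betw_def by simp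
  have G: "G \<in> carrier_mat k k" unfolding G_def using sub by (intro carrier_matI) auto
  have G_nth: "G $$ (s, q) = hollow_gram \<Phi> (pick I s) (pick I q)" if s: "s < k" and q: "q < k" for s q
  proof -
    have lt: "pick I s < N" "pick I q < N" using pin s q IN(1) by auto
    have eq: "pick I s = pick I q \<longleftrightarrow> s = q" using pinj s q by (auto simp: inj_on_def)
    have "(transpose_mat (column_submatrix \<Phi> I) * column_submatrix \<Phi> I) $$ (s, q)
      = (\<Sum>r<m. column_submatrix \<Phi> I $$ (r, s) * column_submatrix \<Phi> I $$ (r, q))"
      using sub s q by (simp add: scalar_prod_def lessThan_atLeast0)
    also have "\<dots> = scalar_prod (col \<Phi> (pick I s)) (col \<Phi> (pick I q))"
      unfolding scalar_prod_col[OF \<Phi>(1) lt] using s q by (intro sum.cong refl) (simp add: sub_nth)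
    finally have "G $$ (s, q) = scalar_prod (col \<Phi> (pick I s)) (col \<Phi> (pick I q)) - (if s = q then 1 else 0)"
      unfolding G_def using sub s q by simp
    then show ?thesis
      using unit_norm_columns_scalar_prod[OF \<Phi>(2), of "pick I q"] lt \<Phi>(1)
      unfolding hollow_gram_def eq by auto
  qed
  have "spectral_norm G \<le> \<delta>"
  proof (rule spectral_norm_le[OF \<delta>])
    fix x :: "real vec" assume x: "x \<in> carrier_vec (dim_col G)"
    define X where "X i = x $ inv_into {..<k} (pick I) i" for i
    have X: "X (pick I q) = x $ q" if "q < k" for q
      unfolding X_def using pinj that by simp
    have G_x: "(G *\<^sub>v x) $ s = ip I (hollow_gram \<Phi> (pick I s)) X" if s: "s < k" for s
    proof -
      have "(G *\<^sub>v x) $ s = (\<Sum>q<k. G $$ (s, q) * x $ q)"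
        using G x s by (subst mult_mat_vec_nth) auto
      also have "\<dots> = (\<Sum>q<k. hollow_gram \<Phi> (pick I s) (pick I q) * X (pick I q))"
        using s by (intro sum.cong refl) (simp add: G_nth X)
      also have "\<dots> = ip I (hollow_gram \<Phi> (pick I s)) X"
        unfolding ip_def by (rule sum.reindex_bij_betw[OF bij])
      finally show ?thesis .
    qed
    have "l2_norm_vec (G *\<^sub>v x) = sqrt (\<Sum>s<k. (ip I (hollow_gram \<Phi> (pick I s)) X)\<^sup>2)"
      unfolding l2_norm_vec_sum using G by (simp add: G_x del: index_mult_mat_vec)
    also have "\<dots> = sqrt (\<Sum>i\<in>I. (ip I (hollow_gram \<Phi> i) X)\<^sup>2)"
      by (subst sum.reindex_bij_betw[OF bij]) (rule refl)
    also have "\<dots> \<le> sqrt (\<delta>\<^sup>2 * ip I X X)"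
      using b unfolding block_bound_def by (intro real_sqrt_le_mono) blast
    also have "ip I X X = (\<Sum>q<k. X (pick I q) * X (pick I q))"
      unfolding ip_def by (rule sum.reindex_bij_betw[OF bij, symmetric])
    also have "\<dots> = (\<Sum>q<k. (x $ q)\<^sup>2)"
      by (intro sum.cong refl) (simp add: X power2_eq_square)
    also have "sqrt (\<delta>\<^sup>2 * \<dots>) = \<delta> * l2_norm_vec x"
      unfolding l2_norm_vec_sum using x G \<delta> by (simp add: real_sqrt_mult)
    finally show "l2_norm_vec (G *\<^sub>v x) \<le> \<delta> * l2_norm_vec x" .
  qed
  then show ?thesis unfolding G_def .
qed

section \<open>Coherence parameters as bounds on entries and rows\<close>

lemma ip_hollow_gram_row:
  "ip {..<dim_col \<Phi>} (hollow_gram \<Phi> i) (hollow_gram \<Phi> i) = (\<Sum>j\<in>{..<dim_col \<Phi>} - {i}. (mutual_coherence \<Phi> i j)\<^sup>2)"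
  unfolding ip_def by (intro sum.mono_neutral_cong_right) (auto simp: hollow_gram_def mutual_coherence_def power2_eq_square)

lemma mutual_coherence_sym: "mutual_coherence \<Phi> i j = mutual_coherence \<Phi> j i"
  unfolding mutual_coherence_def using comm_scalar_prod[of "col \<Phi> i" "dim_row \<Phi>" "col \<Phi> j"] by simp

lemma hollow_gram_le_coherence:
  assumes N: "2 \<le> dim_col \<Phi>"
  shows "0 \<le> coherence \<Phi>" and "i < dim_col \<Phi> \<Longrightarrow> j < dim_col \<Phi> \<Longrightarrow> \<bar>hollow_gram \<Phi> i j\<bar> \<le> coherence \<Phi>"
proof -
  let ?S = "{mutual_coherence \<Phi> i j | i j. i < dim_col \<Phi> \<and> j < dim_col \<Phi> \<and> i \<noteq> j}"
  have "?S \<subseteq> (\<lambda>(i, j). mutual_coherence \<Phi> i j) ` ({..<dim_col \<Phi>} \<times> {..<dim_col \<Phi>})" by auto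
  then have fin: "finite ?S" by (rule finite_subset) auto
  have le: "mutual_coherence \<Phi> i j \<le> coherence \<Phi>" if "i < dim_col \<Phi>" "j < dim_col \<Phi>" "i \<noteq> j" for i j
    unfolding coherence_def using that by (intro Max_ge[OF fin]) blast
  show 0: "0 \<le> coherence \<Phi>"
    using le[of 0 1] N unfolding mutual_coherence_def by simp
  show "\<bar>hollow_gram \<Phi> i j\<bar> \<le> coherence \<Phi>" if "i < dim_col \<Phi>" "j < dim_col \<Phi>"
    using le[OF that] 0 unfolding hollow_gram_def mutual_coherence_def by simp
qed

text \<open>Under coherence invariance all rows have the same squared norm, hence each equals the
  average. Otherwise the maximum is needed; it is taken over columns, which symmetry identifies with
  rows.\<close>

lemma row_sum_le_theta:
  fixes \<Phi> :: "real mat"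
  defines "\<theta> \<equiv> if coherence_invariant \<Phi> then mean_sq_coherence \<Phi> else max_avg_sq_coherence \<Phi>"
  assumes N: "2 \<le> dim_col \<Phi>" and i: "i < dim_col \<Phi>"
  shows "ip {..<dim_col \<Phi>} (hollow_gram \<Phi> i) (hollow_gram \<Phi> i) \<le> (real (dim_col \<Phi>) - 1) * \<theta>"
proof -
  define N where "N = dim_col \<Phi>"
  define s where "s i = (\<Sum>j\<in>{..<N} - {i}. (mutual_coherence \<Phi> i j)\<^sup>2)" for i
  have N2: "2 \<le> real N" using N unfolding N_def by simp
  have "s i \<le> (real N - 1) * \<theta>"
  proof (cases "coherence_invariant \<Phi>")
    case True
    have "s i' = s i" if i': "i' < N" for i'
    proof -
      have s_mset: "s l = sum_mset (image_mset power2 (image_mset (mutual_coherence \<Phi> l) (mset_set ({..<N} - {l}))))" for l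
        unfolding s_def by (simp add: sum_unfold_sum_mset image_mset.compositionality comp_def)
      show ?thesis
        unfolding s_mset using True i' i unfolding coherence_invariant_def N_def by metis
    qed
    then have "mean_sq_coherence \<Phi> = 1 / (real N * (real N - 1)) * (real N * s i)"
      unfolding mean_sq_coherence_def Let_def N_def[symmetric] s_def[symmetric] by simp
    then show ?thesis using True N2 unfolding \<theta>_def by simp
  next
    case False
    have "s i = (\<Sum>l\<in>{..<N} - {i}. (mutual_coherence \<Phi> l i)\<^sup>2)"
      unfolding s_def by (simp only: mutual_coherence_sym[of _ i])
    then have "1 / (real N - 1) * s i \<le> max_avg_sq_coherence \<Phi>"
      unfolding max_avg_sq_coherence_def Let_def N_def[symmetric]
      using i unfolding N_def[symmetric] by (intro Max_ge) auto
    then show ?thesis using False N2 unfolding \<theta>_def by (simp add: field_simps)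
  qed
  then show ?thesis unfolding ip_hollow_gram_row s_def N_def .
qed

lemma strip_of_count:
  assumes \<Phi>: "\<Phi> \<in> carrier_mat m N" "unit_norm_columns \<Phi>" and kN: "k \<le> N" and \<delta>: "0 \<le> \<delta>"
    and count: "real (card {I \<in> ksubsets {..<N} k. \<not> block_bound (hollow_gram \<Phi>) (\<delta>\<^sup>2) I I}) \<le> real (N choose k) * \<epsilon>"
  shows "strip \<Phi> k \<delta> \<epsilon>"
proof -
  let ?A = "ksubsets {..<N} k"
  let ?bad = "{I \<in> ?A. \<not> block_bound (hollow_gram \<Phi>) (\<delta>\<^sup>2) I I}"
  define S where "S = {I. spectral_norm (transpose_mat (column_submatrix \<Phi> I) * column_submatrix \<Phi> I - 1\<^sub>m k) \<le> \<delta>}"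
  have fin: "finite ?A" by (rule finite_ksubsets) simp
  have cA: "card ?A = N choose k" by (simp add: card_ksubsets)
  have pos: "0 < card ?A" unfolding cA using kN by (simp add: zero_less_binomial_iff)
  then have ne: "?A \<noteq> {}" by auto
  have "?A - ?bad \<subseteq> ?A \<inter> S"
    unfolding S_def using spectral_norm_hollow_gram_le[OF \<Phi> _ _ \<delta>] by auto
  then have "card (?A - ?bad) \<le> card (?A \<inter> S)" using fin by (intro card_mono) auto
  moreover have "card (?A - ?bad) = card ?A - card ?bad" using fin by (intro card_Diff_subset) auto
  ultimately have "real (card ?A) - real (card ?bad) \<le> real (card (?A \<inter> S))" by linarith
  then have "real (card ?A) * (1 - \<epsilon>) \<le> real (card (?A \<inter> S))"
    using count unfolding cA by (simp add: algebra_simps)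
  then have "1 - \<epsilon> \<le> real (card (?A \<inter> S)) / real (card ?A)" using pos by (simp add: field_simps)
  also have "\<dots> = measure_pmf.prob (pmf_of_set ?A) S" by (rule measure_pmf_of_set[OF ne fin, symmetric])
  finally have "1 - \<epsilon> \<le> measure_pmf.prob (pmf_of_set ?A) S" .
  moreover have "dim_col \<Phi> = N" using \<Phi>(1) by simp
  ultimately show ?thesis unfolding strip_def S_def ksubsets_def by simp
qed

theorem theorem4p7:
  fixes \<Phi> :: "real mat" and m N k :: nat and \<mu> \<theta> \<delta> \<epsilon> a b c :: real
  assumes "\<Phi> \<in> carrier_mat m N"
    and "unit_norm_columns \<Phi>"
    and "\<mu> = coherence \<Phi>"
    and "\<theta> = (if coherence_invariant \<Phi> then mean_sq_coherence \<Phi> else max_avg_sq_coherence \<Phi>)"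
    and "1 \<le> k" and "k \<le> N"
    and "0 < \<delta>" and "\<delta> < 1"
    and "0 < \<epsilon>" and "\<epsilon> < min (1 / real k) (exp (1 - 1 / ln 2))"
    and "0 < a" and "a < 1" and "0 < b" and "b < 1" and "0 < c" and "c < 1"
    and "real k * \<mu> ^ 4 \<le>
           1 / (ln (1 / \<epsilon>))\<^sup>2 *
             min ((1 - a)\<^sup>2 * b\<^sup>2 / (32 * ln (2 * real k) * ln (exp 1 / \<epsilon>))) (c\<^sup>2)"
    and "real k * \<theta> \<le> a * b / ln (1 / \<epsilon>)"
    and "sqrt b + sqrt (2 * a * b) + sqrt c + 2 * real k / real N * (spectral_norm \<Phi>)\<^sup>2
           \<le> exp (- 1 / 4) * \<delta> / (6 * sqrt 2)"
  shows "strip \<Phi> k \<delta> \<epsilon>"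
proof -
  have N: "dim_col \<Phi> = N" "0 < N" using assms(1,5,6) by auto
  have "real (card {I \<in> ksubsets {..<N} k. \<not> block_bound (hollow_gram \<Phi>) (\<delta>\<^sup>2) I I}) \<le> real (N choose k) * \<epsilon>"
  proof (cases "k = 1")
    \<comment> \<open>A single index leaves no pair to decouple, and \<open>N = 1\<close>, where
      \<open>coherence\<close> is unspecified, is possible here; the block is 0. For
      \<open>k \<ge> 2\<close> also \<open>N \<ge> 2\<close>.\<close>
    case True
    have "block_bound (hollow_gram \<Phi>) (\<delta>\<^sup>2) I I" if I: "I \<in> ksubsets {..<N} k" for I
    proof -
      obtain i where "I = {i}" using I True by (auto simp: ksubsets_def card_1_singleton_iff)
      then show ?thesis unfolding block_bound_def ip_def by (simp add: hollow_gram_diag)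
    qed
    then have "{I \<in> ksubsets {..<N} k. \<not> block_bound (hollow_gram \<Phi>) (\<delta>\<^sup>2) I I} = {}" by blast
    then have "card {I \<in> ksubsets {..<N} k. \<not> block_bound (hollow_gram \<Phi>) (\<delta>\<^sup>2) I I} = 0" by (simp only: card.empty)
    then show ?thesis using assms(9) by simp
  next
    case False
    then have k2: "2 \<le> k" using assms(5) by simp
    then have N2: "2 \<le> dim_col \<Phi>" using assms(6) N by simp
    have \<epsilon>: "\<epsilon> < 1 / real k" using assms(10) by simp
    have "1 / real k \<le> 1" using k2 by simp
    then have L: "0 < ln (1 / \<epsilon>)" using \<epsilon> assms(9) by simp
    have "real (card {I \<in> ksubsets {..<N} k. \<not> block_bound (hollow_gram \<Phi>) (\<delta>\<^sup>2) I I}) \<le> real (card {..<N} choose k) * \<epsilon>"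
    proof (rule random_principal_block[where \<mu> = \<mu> and \<Lambda> = "(spectral_norm \<Phi>)\<^sup>2" and a = a and b = b and c = c])
      show "block_bound (hollow_gram \<Phi>) (((spectral_norm \<Phi>)\<^sup>2)\<^sup>2) {..<N} {..<N}"
        by (rule block_bound_hollow_gram[OF assms(1,2) N(2)])
      show "1 \<le> (spectral_norm \<Phi>)\<^sup>2" by (rule spectral_norm_ge_1[OF assms(1,2) N(2)])
      show "\<bar>hollow_gram \<Phi> i j\<bar> \<le> \<mu>" if "i \<in> {..<N}" "j \<in> {..<N}" for i j
        using hollow_gram_le_coherence(2)[OF N2, of i j] that N assms(3) by simp
      show "0 \<le> \<mu>" using hollow_gram_le_coherence(1)[OF N2] assms(3) by simp
      show "real k * ip {..<N} (hollow_gram \<Phi> i) (hollow_gram \<Phi> i) \<le> real (card {..<N}) * (a * b / ln (1 / \<epsilon>))"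
        if "i \<in> {..<N}" for i
      proof -
        have "real k * ip {..<N} (hollow_gram \<Phi> i) (hollow_gram \<Phi> i) \<le> real k * ((real N - 1) * \<theta>)"
          using row_sum_le_theta[OF N2, of i] that N assms(4) by (intro mult_left_mono) auto
        also have "\<dots> = (real N - 1) * (real k * \<theta>)" by simp
        also have "\<dots> \<le> (real N - 1) * (a * b / ln (1 / \<epsilon>))"
          using assms(18) N by (intro mult_left_mono) auto
        also have "\<dots> \<le> real N * (a * b / ln (1 / \<epsilon>))"
          using assms(11,13) L by (intro mult_right_mono) auto
        finally show ?thesis by simp
      qed
      show "sqrt b + sqrt (2 * a * b) + sqrt c + 2 * real k / real (card {..<N}) * (spectral_norm \<Phi>)\<^sup>2
        \<le> exp (- 1 / 4) * \<delta> / (6 * sqrt 2)"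
        using assms(19) by simp
    qed (use assms k2 \<epsilon> in \<open>simp_all add: hollow_gram_sym hollow_gram_diag\<close>)
    then show ?thesis by simp
  qed
  then show ?thesis using assms(1,2,6,7) by (intro strip_of_count) auto
qed

end
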